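(* Let $S$ be the set of pure $O$-sequences of socle degree $3$, i.e. of the form $(1,h_1,h_2,h_3)$ with $h_3>0$. Then: (i) if $(1,h_1',h_2,h_3)\in S$ and $(1,h_1'',h_2,h_3)\in S$ and $h_1'\le h_1\le h_1''$, then $(1,h_1,h_2,h_3)\in S$; (ii) if $(1,h_1,h_2',h_3)\in S$ and $(1,h_1,h_2'',h_3)\in S$ and $h_2'\le h_2\le h_2''$, then $(1,h_1,h_2,h_3)\in S$; (iii) if $(1,h_1,h_2,h_3')\in S$ and $(1,h_1,h_2,h_3'')\in S$ and $h_3'\le h_3\le h_3''$, then $(1,h_1,h_2,h_3)\in S$.
   Context: A monomial order ideal is a finite nonempty set of monomials (in some polynomial ring) closed under taking divisors; it is pure if all its maximal monomials under divisibility have the same degree $e$, called the socle degree. A pure $O$-sequence is the vector $(h_0,\dots,h_e)$ where $h_i$ is the number of monomials of degree $i$ in a pure monomial order ideal of socle degree $e$. *)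

theory Defs
  imports "HOL-Library.Multiset"
begin

text \<open>
  A monomial in the variables \<open>x\<^sub>0, x\<^sub>1, x\<^sub>2, \<dots>\<close> is the multiset of the indices of its
  variables, so divisibility is \<open>\<subseteq>#\<close> and the degree is \<open>size\<close>. An order ideal is finite, so it
  involves only finitely many variables; taking the indices from \<open>nat\<close> therefore covers
  polynomial rings in any number of variables.
\<close>

type_synonym monomial = "nat multiset"

definition monomial_order_ideal :: "monomial set \<Rightarrow> bool" where
  "monomial_order_ideal X \<longleftrightarrow>
     finite X \<and> X \<noteq> {} \<and> (\<forall>m\<in>X. \<forall>d. d \<subseteq># m \<longrightarrow> d \<in> X)"

definition maximal_monomials :: "monomial set \<Rightarrow> monomial set" where
  "maximal_monomials X = {m \<in> X. \<not> (\<exists>n\<in>X. m \<subset># n)}"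

definition pure_order_ideal :: "nat \<Rightarrow> monomial set \<Rightarrow> bool" where
  "pure_order_ideal e X \<longleftrightarrow>
     monomial_order_ideal X \<and> (\<forall>m\<in>maximal_monomials X. size m = e)"

definition h_vector :: "nat \<Rightarrow> monomial set \<Rightarrow> nat list" where
  "h_vector e X = map (\<lambda>i. card {m \<in> X. size m = i}) [0..<Suc e]"

definition pure_O_sequences :: "nat \<Rightarrow> nat list set" where
  "pure_O_sequences e = {h_vector e X | X. pure_order_ideal e X}"

lemma pure_O_sequences_3_form:
  assumes "h \<in> pure_O_sequences 3"
  shows "\<exists>h1 h2 h3. h = [1, h1, h2, h3] \<and> h3 > 0"
proof -
  obtain X where X: "pure_order_ideal 3 X" and h: "h = h_vector 3 X"
    using assms by (auto simp: pure_O_sequences_def)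
  have fin: "finite X" and ne: "X \<noteq> {}" and dc: "\<And>m d. m \<in> X \<Longrightarrow> d \<subseteq># m \<Longrightarrow> d \<in> X"
    and mx: "\<And>m. m \<in> maximal_monomials X \<Longrightarrow> size m = 3"
    using X by (auto simp: pure_order_ideal_def monomial_order_ideal_def)
  have "{#} \<in> X" using ne dc by force
  then have "{m \<in> X. size m = 0} = {{#}}" by auto
  then have c0: "card {m \<in> X. size m = 0} = 1" by simp
  obtain m where m: "m \<in> X" and mmax: "\<And>n. n \<in> X \<Longrightarrow> m \<subseteq># n \<Longrightarrow> m = n"
    using subset_mset.finite_has_maximal[OF fin ne] by blast
  have "m \<in> maximal_monomials X"
    using m mmax by (auto simp: maximal_monomials_def subset_mset_def)
  then have "m \<in> {m \<in> X. size m = 3}" using m mx by simp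
  then have "card {m \<in> X. size m = 3} > 0" using fin by (auto simp: card_gt_0_iff)
  then show ?thesis using c0 unfolding h h_vector_def
    by (simp add: upt_rec numeral_3_eq_3 del: size_eq_0_iff_empty)
qed

end

theory Submission
  imports Defs
begin

text \<open>
  A pure order ideal of socle degree 3 is determined by its set \<open>T\<close> of cubics; write
  \<open>Q\<close> for the quadratic divisors and \<open>(r, a, b)\<close> for the numbers of variables, quadrics and cubics.

  For \<open>b \<le> a\<close> the realizable triples are closed under lowering \<open>a\<close> and raising \<open>r\<close> and \<open>b\<close> within
  \<open>r \<le> a\<close> and \<open>b \<le> a\<close>. This is shown by exchanging one cubic of an irredundant \<open>T\<close> at a time, so
  the maximal number of quadrics (a question about triple systems) is never computed.

  For \<open>b \<ge> a\<close>, a system of distinct representatives that assigns to each variable a quadric containing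
  it allows to replace quadrics \<open>xy\<close> by squares \<open>x\<^sup>2\<close> without decreasing the number of cubics over
  \<open>Q\<close>. Once all squares are present, \<open>Q\<close> is a simple graph on \<open>r\<close> vertices with \<open>p = a - r\<close> edges, and
  the possible \<open>b\<close> are those with \<open>a \<le> b \<le> r + 2p + t\<close>, where \<open>t\<close> counts triangles. A shifting argument
  shows that trading a vertex for an edge does not cost triangles.
\<close>

subsection \<open>Sets of cubics\<close>

definition quads :: "monomial \<Rightarrow> monomial set" where
  "quads m = {d. d \<subseteq># m \<and> size d = 2}"

definition shadow :: "monomial set \<Rightarrow> monomial set" where
  "shadow T = (\<Union>m\<in>T. quads m)"

definition vars :: "monomial set \<Rightarrow> nat set" where
  "vars T = (\<Union>m\<in>T. set_mset m)"

definition cubics :: "monomial set \<Rightarrow> bool" where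
  "cubics T \<longleftrightarrow> finite T \<and> (\<forall>m\<in>T. size m = 3)"

definition realizable :: "nat \<Rightarrow> nat \<Rightarrow> nat \<Rightarrow> bool" where
  "realizable r a b \<longleftrightarrow>
     (\<exists>T. cubics T \<and> card (vars T) = r \<and> card (shadow T) = a \<and> card T = b)"

section \<open>Monomials of degree two and three and their quadratic divisors\<close>

lemma size_2_cases:
  assumes "size m = 2"
  obtains x y where "m = {#x, y#}"
  using assms by (metis One_nat_def Suc_1 size_1_singleton_mset size_eq_Suc_imp_eq_union size_add_mset nat.inject)

lemma size_3_cases:
  assumes "size m = 3"
  obtains x y z where "m = {#x, y, z#}"
proof -
  obtain x k where k: "m = add_mset x k" using assms size_eq_Suc_imp_eq_union[of m 2] by auto
  then have "size k = 2" using assms by simp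
  then obtain y z where "k = {#y, z#}" by (rule size_2_cases)
  then show thesis using k that by blast
qed

lemma size_3_member_cases:
  assumes "size m = 3" "x \<in># m"
  obtains y z where "m = {#x, y, z#}"
proof -
  have "size (m - {#x#}) = 2" using assms by (simp add: size_Diff_singleton)
  then obtain y z where "m - {#x#} = {#y, z#}" by (rule size_2_cases)
  then have "m = {#x, y, z#}" using assms(2) by (metis insert_DiffM)
  then show thesis by (rule that)
qed

lemma size_3_quads_cases:
  assumes "size m = 3" "{#x, y#} \<in> quads m"
  obtains z where "m = {#x, y, z#}"
proof -
  obtain k where k: "m = {#x, y#} + k"
    using assms(2) by (auto simp: quads_def subset_mset.le_iff_add)
  then have "size k = 1" using assms(1) by simp
  then obtain z where "k = {#z#}" using size_1_singleton_mset by blast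
  then have "m = {#x, y, z#}" using k by (simp add: add_mset_commute)
  then show thesis by (rule that)
qed

lemma quads_triple [simp]: "quads {#x, y, z#} = {{#x, y#}, {#x, z#}, {#y, z#}}"
proof (intro equalityI subsetI)
  fix d assume d: "d \<in> quads {#x, y, z#}"
  then obtain k where k: "{#x, y, z#} = d + k" and sz: "size d = 2"
    by (auto simp: quads_def subset_mset.le_iff_add)
  have "size {#x, y, z#} = size d + size k" by (simp only: k size_union)
  then have "size k = 1" using sz by simp
  then obtain u where u: "k = {#u#}" using size_1_singleton_mset by blast
  have "{#x, y, z#} - {#x#} = {#y, z#}" "{#x, y, z#} - {#y#} = {#x, z#}"
    "{#x, y, z#} - {#z#} = {#x, y#}" by (simp_all add: add_mset_commute[of x])
  moreover have "d = {#x, y, z#} - {#u#}" using k u by simp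
  moreover have "u \<in># {#x, y, z#}" by (simp only: k u) simp
  ultimately show "d \<in> {{#x, y#}, {#x, z#}, {#y, z#}}" by auto
next
  fix d assume "d \<in> {{#x, y#}, {#x, z#}, {#y, z#}}"
  then show "d \<in> quads {#x, y, z#}"
    by (auto simp: quads_def subseteq_mset_def)
qed

lemma finite_submultisets: "finite {d. d \<subseteq># (m :: monomial)}"
proof (induction m)
  case empty
  then show ?case by simp
next
  case (add x m)
  have "{d. d \<subseteq># add_mset x m} \<subseteq> {d. d \<subseteq># m} \<union> add_mset x ` {d. d \<subseteq># m}"
  proof
    fix d assume d: "d \<in> {d. d \<subseteq># add_mset x m}"
    show "d \<in> {d. d \<subseteq># m} \<union> add_mset x ` {d. d \<subseteq># m}"
    proof (cases "x \<in># d")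
      case True
      then obtain e where "d = add_mset x e" by (metis insert_DiffM)
      then show ?thesis using d by auto
    next
      case False
      have "count d y \<le> count m y" for y
        using d False by (cases "y = x") (auto simp: subseteq_mset_def not_in_iff dest: spec[of _ y])
      then show ?thesis by (simp add: subseteq_mset_def)
    qed
  qed
  then show ?case using add by (meson finite_UnI finite_imageI finite_subset)
qed

lemma finite_quads [simp]: "finite (quads m)"
  unfolding quads_def by (rule finite_subset[OF _ finite_submultisets[of m]]) auto

lemma finite_shadow: "cubics T \<Longrightarrow> finite (shadow T)"
  by (simp add: cubics_def shadow_def)

lemma finite_vars: "cubics T \<Longrightarrow> finite (vars T)"
  by (simp add: cubics_def vars_def)

lemma shadow_insert [simp]: "shadow (insert m T) = quads m \<union> shadow T"
  by (simp add: shadow_def)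

lemma vars_insert [simp]: "vars (insert m T) = set_mset m \<union> vars T"
  by (simp add: vars_def)

text \<open>Each variable of a cubic divides one of its quadratic divisors. So exchanges of cubics
  that keep the shadow also keep the variables.\<close>

lemma vars_eq_vars_shadow:
  assumes "cubics T"
  shows "vars T = vars (shadow T)"
proof -
  have "set_mset m = vars (quads m)" if "m \<in> T" for m
  proof -
    have "size m = 3" using assms that by (simp add: cubics_def)
    then obtain x y z where m: "m = {#x, y, z#}" by (rule size_3_cases)
    show ?thesis unfolding m by (auto simp: vars_def)
  qed
  then show ?thesis unfolding vars_def shadow_def by fastforce
qed

lemma card_quads_le: "size m = 3 \<Longrightarrow> card (quads m) \<le> 3"
  by (erule size_3_cases) (simp add: card_insert_if)

text \<open>A pure ideal is the set of divisors of its cubics, and conversely the divisors of a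
  nonempty set of cubics form a pure ideal with exactly these cubics in degree 3.\<close>

lemma realizable_iff:
  "[1, r, a, b] \<in> pure_O_sequences 3 \<longleftrightarrow> realizable r a b \<and> 0 < b"
proof
  assume "[1, r, a, b] \<in> pure_O_sequences 3"
  then obtain X where X: "pure_order_ideal 3 X" and h: "[1, r, a, b] = h_vector 3 X"
    by (auto simp: pure_O_sequences_def)
  have "0 < b" using pure_O_sequences_3_form \<open>[1, r, a, b] \<in> pure_O_sequences 3\<close> by force
  have fin: "finite X" and dc: "\<And>m d. m \<in> X \<Longrightarrow> d \<subseteq># m \<Longrightarrow> d \<in> X"
    and mx: "\<And>m. m \<in> maximal_monomials X \<Longrightarrow> size m = 3"
    using X by (auto simp: pure_order_ideal_def monomial_order_ideal_def)
  define T where "T = {m \<in> X. size m = 3}"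
  \<comment> \<open>Purity enters here: every monomial of the finite set \<open>X\<close> divides a
    maximal one, which has degree 3.\<close>
  have above: "\<exists>m\<in>T. d \<subseteq># m" if "d \<in> X" for d
  proof -
    obtain m where m: "m \<in> X" "d \<subseteq># m" "\<And>n. n \<in> X \<Longrightarrow> m \<subseteq># n \<Longrightarrow> m = n"
      using subset_mset.finite_has_maximal2[OF fin \<open>d \<in> X\<close>] by blast
    then have "m \<in> maximal_monomials X"
      by (auto simp: maximal_monomials_def subset_mset_def)
    then show ?thesis using m mx by (auto simp: T_def)
  qed
  have T: "cubics T" using fin by (simp add: T_def cubics_def)
  have 2: "{m \<in> X. size m = 2} = shadow T"
    using above dc by (auto simp: shadow_def quads_def T_def)
  have 1: "{m \<in> X. size m = 1} = (\<lambda>x. {#x#}) ` vars T"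
  proof (intro equalityI subsetI)
    fix m assume m: "m \<in> {m \<in> X. size m = 1}"
    then obtain x where "m = {#x#}" using size_1_singleton_mset[of m] by auto
    then show "m \<in> (\<lambda>x. {#x#}) ` vars T" using m above[of m] by (auto simp: vars_def)
  qed (use dc in \<open>auto simp: vars_def T_def\<close>)
  have "card {m \<in> X. size m = 1} = card (vars T)"
    unfolding 1 by (rule card_image) (simp add: inj_on_def)
  moreover have upt: "[0..<Suc 3] = [0, 1, 2, 3]" by (simp add: upt_rec)
  ultimately have "card (vars T) = r" "card (shadow T) = a" "card T = b"
    using h 2 unfolding h_vector_def upt T_def by simp_all
  then show "realizable r a b \<and> 0 < b" using T \<open>0 < b\<close> unfolding realizable_def by blast
next
  assume "realizable r a b \<and> 0 < b"
  then obtain T where T: "cubics T" "card (vars T) = r" "card (shadow T) = a" "card T = b"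
    and "T \<noteq> {}"
    unfolding realizable_def by fastforce
  define X where "X = {d. \<exists>m\<in>T. d \<subseteq># m}"
  have "X = (\<Union>m\<in>T. {d. d \<subseteq># m})" by (auto simp: X_def)
  then have "finite X" using T finite_submultisets by (auto simp: cubics_def)
  moreover have "X \<noteq> {}" using \<open>T \<noteq> {}\<close> by (auto simp: X_def)
  moreover have "\<forall>m\<in>X. \<forall>d. d \<subseteq># m \<longrightarrow> d \<in> X"
    by (auto simp: X_def intro: subset_mset.order_trans)
  moreover have "\<forall>m\<in>maximal_monomials X. size m = 3"
  proof
    fix m assume m: "m \<in> maximal_monomials X"
    then obtain n where n: "n \<in> T" "m \<subseteq># n" by (auto simp: maximal_monomials_def X_def)
    then have "n \<in> X" by (auto simp: X_def)
    then have "m = n" using m n by (auto simp: maximal_monomials_def subset_mset_def)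
    then show "size m = 3" using n T by (simp add: cubics_def)
  qed
  ultimately have X: "pure_order_ideal 3 X"
    by (simp add: pure_order_ideal_def monomial_order_ideal_def)
  have 3: "{m \<in> X. size m = 3} = T"
  proof (intro equalityI subsetI)
    fix m assume "m \<in> {m \<in> X. size m = 3}"
    then obtain n where "n \<in> T" "m \<subseteq># n" "size m = size n"
      using T by (auto simp: X_def cubics_def)
    then show "m \<in> T" using mset_subset_size by (fastforce simp: subset_mset.le_less)
  qed (use T in \<open>auto simp: X_def cubics_def\<close>)
  have 2: "{m \<in> X. size m = 2} = shadow T"
    by (auto simp: shadow_def quads_def X_def)
  have 1: "{m \<in> X. size m = 1} = (\<lambda>x. {#x#}) ` vars T"
  proof (intro equalityI subsetI)
    fix m assume m: "m \<in> {m \<in> X. size m = 1}"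
    then obtain x where "m = {#x#}" using size_1_singleton_mset[of m] by auto
    then show "m \<in> (\<lambda>x. {#x#}) ` vars T" using m by (auto simp: vars_def X_def)
  qed (auto simp: vars_def X_def)
  have 1: "card {m \<in> X. size m = 1} = card (vars T)"
    unfolding 1 by (rule card_image) (simp add: inj_on_def)
  have "{#} \<in> X" using \<open>T \<noteq> {}\<close> by (auto simp: X_def)
  then have "{m \<in> X. size m = 0} = {{#}}" by auto
  then have "card {m \<in> X. size m = 0} = 1" by simp
  moreover have "[0..<Suc 3] = [0, 1, 2, 3]" by (simp add: upt_rec)
  ultimately have "h_vector 3 X = [1, r, a, b]"
    using 1 2 3 T by (simp add: h_vector_def del: size_eq_0_iff_empty)
  then show "[1, r, a, b] \<in> pure_O_sequences 3"
    using X unfolding pure_O_sequences_def by (metis (mono_tags, lifting) mem_Collect_eq)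
qed

subsection \<open>Raising the number of cubics\<close>

text \<open>Equivalently, every cubic has a private quadric: one that divides no other cubic of
  \<open>T\<close>.\<close>

definition irredundant :: "monomial set \<Rightarrow> bool" where
  "irredundant T \<longleftrightarrow> (\<forall>m\<in>T. shadow (T - {m}) \<noteq> shadow T)"

lemma cubics_Diff: "cubics T \<Longrightarrow> cubics (T - S)"
  by (simp add: cubics_def)

lemma cubics_insert: "cubics T \<Longrightarrow> size m = 3 \<Longrightarrow> cubics (insert m T)"
  by (simp add: cubics_def)

lemma shadow_remove:
  "m \<in> T \<Longrightarrow> shadow T = quads m \<union> shadow (T - {m})"
  by (metis insert_Diff shadow_insert)

lemma vars_remove:
  "m \<in> T \<Longrightarrow> vars T = set_mset m \<union> vars (T - {m})"
  by (metis insert_Diff vars_insert)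

lemma vars_eqI: "cubics T \<Longrightarrow> cubics S \<Longrightarrow> shadow T = shadow S \<Longrightarrow> vars T = vars S"
  by (metis vars_eq_vars_shadow)

lemma in_shadowE:
  assumes "cubics T" "{#x, y#} \<in> shadow T"
  obtains z where "{#x, y, z#} \<in> T"
proof -
  obtain m where m: "m \<in> T" "{#x, y#} \<in> quads m" using assms(2) by (auto simp: shadow_def)
  then have "size m = 3" using assms(1) by (simp add: cubics_def)
  with m show thesis by (metis size_3_quads_cases that)
qed

lemma in_shadow_size: "q \<in> shadow T \<Longrightarrow> size q = 2"
  by (auto simp: shadow_def quads_def)

lemma in_shadow_vars: "q \<in> shadow T \<Longrightarrow> x \<in># q \<Longrightarrow> x \<in> vars T"
  by (auto simp: shadow_def quads_def vars_def dest: mset_subset_eqD)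

text \<open>A missing square \<open>x^2\<close> is traded for a mixed quadric. A cubic divisible by
  \<open>x\<close> is removed; one of its quadrics is private by irredundancy. At most two new
  cubics bring in \<open>x^2\<close> and restore all removed quadrics except one private mixed
  quadric, which becomes \<open>{#y, z#}\<close>.\<close>

lemma square_swap:
  assumes T: "cubics T" and irr: "irredundant T" and x: "x \<in> vars T"
    and xx: "{#x, x#} \<notin> shadow T"
  obtains T' y z where "cubics T'" "card T' \<le> Suc (card T)" "y \<noteq> z" "{#y, z#} \<in> shadow T"
    "shadow T' = insert {#x, x#} (shadow T - {{#y, z#}})" "vars T' = vars T"
proof -
  note result = that
  have fin: "finite T" using T by (simp add: cubics_def)
  \<comment> \<open>Only \<open>{#y, z#}\<close> leaves the shadow, so only \<open>y\<close> and
    \<open>z\<close> could disappear as variables; the last two assumptions exclude this.\<close>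
  have main: thesis if T': "cubics T'" "card T' \<le> Suc (card T)" and yz: "y \<noteq> z" "{#y, z#} \<in> shadow T"
    and sh: "shadow T' = insert {#x, x#} (shadow T - {{#y, z#}})"
    and y: "y \<in> vars T'" and z: "z \<in> vars T'" for T' y z
  proof (rule result[OF T' yz sh])
    have "vars T' \<subseteq> vars T"
      unfolding vars_eq_vars_shadow[OF T'(1)] sh
      using x by (auto simp: vars_def[of "shadow T - _"] dest: in_shadow_vars)
    moreover have "vars T \<subseteq> vars T'"
    proof
      fix u assume "u \<in> vars T"
      then obtain q where q: "q \<in> shadow T" "u \<in># q"
        unfolding vars_eq_vars_shadow[OF T] by (auto simp: vars_def)
      show "u \<in> vars T'"
      proof (cases "q = {#y, z#}")
        case True
        then show ?thesis using q y z by auto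
      next
        case False
        then have "q \<in> shadow T'" using q sh by simp
        then show ?thesis using q in_shadow_vars by blast
      qed
    qed
    ultimately show "vars T' = vars T" by blast
  qed
  obtain m where "m \<in> T" "x \<in># m" using x by (auto simp: vars_def)
  moreover have "size m = 3" using T \<open>m \<in> T\<close> by (simp add: cubics_def)
  ultimately obtain y z where m: "{#x, y, z#} \<in> T" by (metis size_3_member_cases)
  have card_le: "card (insert n (insert n' (T - {m}))) \<le> Suc (card T)" if "m \<in> T" for n n' m
  proof -
    have "card (insert n (insert n' (T - {m}))) \<le> Suc (Suc (card (T - {m})))"
      using fin by (simp add: card_insert_if)
    also have "\<dots> = Suc (card T)" using that fin by (metis card.remove)
    finally show ?thesis .
  qed
  have card_le': "card (insert n (T - {m})) \<le> Suc (card T)" if "m \<in> T" for n m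
    using card_le[OF that, of n n] by simp
  have step: thesis if m: "{#x, y, z#} \<in> T" and "y \<noteq> z" for y z
  proof -
    let ?m = "{#x, y, z#}"
    let ?T = "T - {?m}"
    note sT = shadow_remove[OF m]
    have cT: "cubics ?T" using T by (rule cubics_Diff)
    have "x \<noteq> y" "x \<noteq> z" using sT xx by auto
    \<comment> \<open>Irredundancy gives a private quadric among the three. It is the one to be
      dropped.\<close>
    consider "{#y, z#} \<notin> shadow ?T" | "{#y, z#} \<in> shadow ?T" "{#x, z#} \<notin> shadow ?T"
      | "{#y, z#} \<in> shadow ?T" "{#x, y#} \<notin> shadow ?T"
      using irr m sT by (auto simp: irredundant_def)
    then show thesis
    proof cases
      case 1
      show thesis
      proof (rule main[of "insert {#x, x, y#} (insert {#x, x, z#} ?T)" y z])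
        show "shadow (insert {#x, x, y#} (insert {#x, x, z#} ?T)) =
          insert {#x, x#} (shadow T - {{#y, z#}})"
          using 1 sT xx \<open>x \<noteq> y\<close> \<open>x \<noteq> z\<close> by (auto simp: add_eq_conv_ex)
      qed (use cT m card_le sT \<open>y \<noteq> z\<close> in \<open>auto intro!: cubics_insert\<close>)
    next
      case 2
      show thesis
      proof (rule main[of "insert {#x, x, y#} ?T" x z])
        show "shadow (insert {#x, x, y#} ?T) = insert {#x, x#} (shadow T - {{#x, z#}})"
          using 2 sT xx \<open>x \<noteq> z\<close> \<open>y \<noteq> z\<close> by (auto simp: add_eq_conv_ex)
        show "z \<in> vars (insert {#x, x, y#} ?T)" using 2 in_shadow_vars by fastforce
      qed (use cT m card_le' sT \<open>x \<noteq> z\<close> in \<open>auto intro!: cubics_insert\<close>)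
    next
      case 3
      show thesis
      proof (rule main[of "insert {#x, x, z#} ?T" x y])
        show "shadow (insert {#x, x, z#} ?T) = insert {#x, x#} (shadow T - {{#x, y#}})"
          using 3 sT xx \<open>x \<noteq> y\<close> \<open>y \<noteq> z\<close> by (auto simp: add_eq_conv_ex)
        show "y \<in> vars (insert {#x, x, z#} ?T)" using 3 in_shadow_vars by fastforce
      qed (use cT m card_le' sT \<open>x \<noteq> y\<close> in \<open>auto intro!: cubics_insert\<close>)
    qed
  qed
  show thesis
  proof (cases "y = z")
    case False
    then show thesis using step m by blast
  next
    case True
    let ?T = "T - {{#x, y, y#}}"
    have m: "{#x, y, y#} \<in> T" using m True by simp
    note sT = shadow_remove[OF m]
    have cT: "cubics ?T" using T by (rule cubics_Diff)
    have "x \<noteq> y" using sT xx by auto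
    show thesis
    proof (cases "{#x, y#} \<in> shadow ?T")
      case True
      \<comment> \<open>The cubic \<open>{#x, y, y#}\<close> is absent from \<open>?T\<close>, so
        this second cubic through \<open>{#x, y#}\<close> has \<open>w\<close> distinct from
        \<open>y\<close> and \<open>step\<close> applies to it.\<close>
      then obtain w where w: "{#x, y, w#} \<in> ?T" using cT in_shadowE by blast
      then have "w \<noteq> y" by auto
      then show thesis using step w by blast
    next
      case False
      show thesis
      proof (cases "{#y, y#} \<in> shadow ?T")
        case True
        show thesis
        proof (rule main[of "insert {#x, x, x#} ?T" x y])
          show "shadow (insert {#x, x, x#} ?T) = insert {#x, x#} (shadow T - {{#x, y#}})"
            using True False sT xx \<open>x \<noteq> y\<close> by (auto simp: add_eq_conv_ex)
          show "y \<in> vars (insert {#x, x, x#} ?T)" using True in_shadow_vars by fastforce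
        qed (use cT m card_le' sT \<open>x \<noteq> y\<close> in \<open>auto intro!: cubics_insert\<close>)
      next
        case yy: False
        show thesis
        proof (rule main[of "insert {#x, x, x#} (insert {#y, y, y#} ?T)" x y])
          show "shadow (insert {#x, x, x#} (insert {#y, y, y#} ?T)) =
            insert {#x, x#} (shadow T - {{#x, y#}})"
            using False sT xx \<open>x \<noteq> y\<close> by (auto simp: add_eq_conv_ex)
        qed (use cT m card_le sT \<open>x \<noteq> y\<close> in \<open>auto intro!: cubics_insert\<close>)
      qed
    qed
  qed
qed

section \<open>The largest set of cubics with shadow inside a given set of quadrics\<close>

definition cubics_over :: "monomial set \<Rightarrow> monomial set" where
  "cubics_over Q = {m. size m = 3 \<and> quads m \<subseteq> Q}"

lemma finite_cubics_over:
  assumes "finite Q"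
  shows "finite (cubics_over Q)"
proof (rule finite_subset)
  show "cubics_over Q \<subseteq> (\<lambda>(q, u). add_mset u q) ` (Q \<times> vars Q)"
  proof
    fix m assume m: "m \<in> cubics_over Q"
    then have "size m = 3" by (simp add: cubics_over_def)
    then obtain x y z where xyz: "m = {#x, y, z#}" by (rule size_3_cases)
    have yz: "{#y, z#} \<in> Q" and xy: "{#x, y#} \<in> Q"
      using m unfolding xyz cubics_over_def by auto
    have "x \<in> vars Q" unfolding vars_def using xy by (rule UN_I) simp
    with yz show "m \<in> (\<lambda>(q, u). add_mset u q) ` (Q \<times> vars Q)"
      unfolding xyz by (auto intro!: image_eqI[of _ _ "({#y, z#}, x)"])
  qed
  show "finite ((\<lambda>(q, u). add_mset u q) ` (Q \<times> vars Q))"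
    using assms by (simp add: vars_def)
qed

lemma cubics_cubics_over: "finite Q \<Longrightarrow> cubics (cubics_over Q)"
  by (simp add: cubics_def finite_cubics_over) (simp add: cubics_over_def)

lemma subset_cubics_over_shadow: "cubics T \<Longrightarrow> T \<subseteq> cubics_over (shadow T)"
  by (auto simp: cubics_def cubics_over_def shadow_def)

lemma shadow_between:
  assumes "T \<subseteq> T'" "T' \<subseteq> cubics_over (shadow T)"
  shows "shadow T' = shadow T"
  using assms by (fastforce simp: shadow_def cubics_over_def)

text \<open>With all squares available, a quadric times one of its own variables is a cubic over
  \<open>Q\<close>. Multiplying by the least variable is injective, because the support of the
  product is that of the quadric and thus determines the factor.\<close>

lemma squares_cover:
  assumes "finite Q" and sz: "\<And>q. q \<in> Q \<Longrightarrow> size q = 2"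
    and sq: "\<And>x. x \<in> vars Q \<Longrightarrow> {#x, x#} \<in> Q"
  obtains T where "T \<subseteq> cubics_over Q" "shadow T = Q" "card T = card Q"
proof
  let ?f = "\<lambda>q. add_mset (Min (set_mset q)) q"
  show sub: "?f ` Q \<subseteq> cubics_over Q"
  proof
    fix m assume "m \<in> ?f ` Q"
    then obtain q where q: "q \<in> Q" and m: "m = ?f q" by blast
    obtain x y where xy: "q = {#x, y#}" using sz[OF q] by (rule size_2_cases)
    have "{#x, x#} \<in> Q" "{#y, y#} \<in> Q" using q sq unfolding xy vars_def by fastforce+
    then show "m \<in> cubics_over Q"
      using q unfolding m xy cubics_over_def by (auto simp: min_def add_mset_commute)
  qed
  have "q \<in> quads (?f q)" if "q \<in> Q" for q using sz[OF that] by (simp add: quads_def)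
  then show "shadow (?f ` Q) = Q" using sub by (fastforce simp: shadow_def cubics_over_def)
  have "inj_on ?f Q"
  proof (rule inj_onI)
    fix p q assume p: "p \<in> Q" and q: "q \<in> Q" and eq: "?f p = ?f q"
    have "p \<noteq> {#}" "q \<noteq> {#}" using p q sz by fastforce+
    then have "set_mset (?f p) = set_mset p" "set_mset (?f q) = set_mset q"
      by (simp_all add: insert_absorb)
    then have "set_mset p = set_mset q" using eq by metis
    then show "p = q" using eq by simp
  qed
  then show "card (?f ` Q) = card Q" by (rule card_image)
qed

text \<open>Redundant cubics are discarded. An irredundant \<open>T\<close> with fewer than
  \<open>b\<close> cubics receives a missing square by \<open>square_swap\<close>, which adds at
  most one cubic and so never overshoots \<open>b\<close>. Once no square is missing,
  \<open>squares_cover\<close> shows that at least \<open>b\<close> cubics lie over the shadow, and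
  \<open>T\<close> is filled up to size \<open>b\<close>.\<close>

lemma raise_card:
  assumes "cubics T" "card T \<le> b" "b \<le> card (shadow T)"
  shows "\<exists>T'. cubics T' \<and> vars T' = vars T \<and> card (shadow T') = card (shadow T) \<and> card T' = b"
  using assms
\<comment> \<open>A swap removes a missing square but may add one cubic, hence the weight 2.\<close>
proof (induction "2 * card {x \<in> vars T. {#x, x#} \<notin> shadow T} + card T" arbitrary: T rule: less_induct)
  case less
  note T = \<open>cubics T\<close>
  have fin: "finite T" using T by (simp add: cubics_def)
  show ?case
  proof (cases "irredundant T")
    case False
    then obtain m where m: "m \<in> T" "shadow (T - {m}) = shadow T" by (auto simp: irredundant_def)
    have c: "cubics (T - {m})" using T by (rule cubics_Diff)
    have v: "vars (T - {m}) = vars T" using vars_eqI[OF c T m(2)] .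
    have "card (T - {m}) < card T" using fin m(1) by (rule card_Diff1_less)
    then show ?thesis using less.hyps[of "T - {m}"] less.prems c v m by simp
  next
    case irr: True
    show ?thesis
    proof (cases "card T = b")
      case True
      then show ?thesis using T by blast
    next
      case False
      show ?thesis
      proof (cases "\<exists>x\<in>vars T. {#x, x#} \<notin> shadow T")
        case True
        then obtain x where x: "x \<in> vars T" "{#x, x#} \<notin> shadow T" by blast
        then obtain T' y z where T': "cubics T'" "card T' \<le> Suc (card T)" "y \<noteq> z"
          "{#y, z#} \<in> shadow T" "vars T' = vars T"
          "shadow T' = insert {#x, x#} (shadow T - {{#y, z#}})"
          using square_swap[OF T irr] by metis
        have "card (shadow T') = Suc (card (shadow T - {{#y, z#}}))"
          using T' x finite_shadow[OF T] by simp
        then have card: "card (shadow T') = card (shadow T)"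
          using T' finite_shadow[OF T] by (metis card.remove)
        have "{u \<in> vars T'. {#u, u#} \<notin> shadow T'} \<subset> {u \<in> vars T. {#u, u#} \<notin> shadow T}"
          using T' x by (auto simp: add_eq_conv_ex)
        then have "card {u \<in> vars T'. {#u, u#} \<notin> shadow T'} < card {u \<in> vars T. {#u, u#} \<notin> shadow T}"
          using finite_vars[OF T] by (intro psubset_card_mono) auto
        then show ?thesis
          using less.hyps[of T'] less.prems T' card False by simp
      next
        case all: False
        have "{#x, x#} \<in> shadow T" if "x \<in> vars (shadow T)" for x
          using that all vars_eq_vars_shadow[OF T] by auto
        then obtain T0 where "T0 \<subseteq> cubics_over (shadow T)" "card T0 = card (shadow T)"
          using squares_cover[OF finite_shadow[OF T] in_shadow_size[of _ T]] by metis
        then have "b \<le> card (cubics_over (shadow T))"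
          using less.prems(3) finite_cubics_over[OF finite_shadow[OF T]] by (metis card_mono order_trans)
        then obtain T' where T': "T \<subseteq> T'" "T' \<subseteq> cubics_over (shadow T)" "card T' = b"
          using exists_subset_between[of T b "cubics_over (shadow T)"] less.prems
            subset_cubics_over_shadow[OF T] finite_cubics_over[OF finite_shadow[OF T]] by blast
        have c: "cubics T'"
          using T' cubics_cubics_over[OF finite_shadow[OF T]] finite_subset unfolding cubics_def by blast
        have "shadow T' = shadow T" using T' shadow_between by blast
        then show ?thesis using c T' vars_eqI[OF c T] by auto
      qed
    qed
  qed
qed

subsection \<open>Lowering the number of quadrics and raising the number of variables\<close>

lemma card_quads: "size m = 3 \<Longrightarrow> card (quads m) = card (set_mset m)"
  by (erule size_3_cases) (auto simp: card_insert_if add_eq_conv_ex)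

lemma card_set_mset_le: "size m = 3 \<Longrightarrow> card (set_mset m) \<le> 3"
  by (erule size_3_cases) (simp add: card_insert_if)

text \<open>Cubics are removed while at least \<open>a\<close> quadrics remain. When every removal
  would fall below \<open>a\<close>, one cubic is replaced by a cubic in some of its own variables
  that contributes exactly the missing number of quadrics.\<close>

lemma reduce_shadow:
  assumes "cubics T" "a \<le> card (shadow T)"
  shows "\<exists>T'. cubics T' \<and> vars T' \<subseteq> vars T \<and> card (shadow T') = a \<and> card T' \<le> card T"
  using assms
proof (induction "card T" arbitrary: T rule: less_induct)
  case less
  note T = \<open>cubics T\<close>
  have fin: "finite T" using T by (simp add: cubics_def)
  consider "a = card (shadow T)" | m where "m \<in> T" "a \<le> card (shadow (T - {m}))"
    | "a < card (shadow T)" "\<And>m. m \<in> T \<Longrightarrow> card (shadow (T - {m})) < a"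
    using less.prems(2) by (metis le_neq_implies_less not_le)
  then show ?case
  proof cases
    case 1
    then show ?thesis using T by blast
  next
    case (2 m)
    have lt: "card (T - {m}) < card T" using fin 2(1) by (rule card_Diff1_less)
    then obtain T' where "cubics T'" "vars T' \<subseteq> vars (T - {m})" "card (shadow T') = a"
      "card T' \<le> card (T - {m})"
      using less.hyps[OF lt cubics_Diff[OF T] 2(2)] by blast
    then show ?thesis using lt vars_remove[OF 2(1)] by (intro exI[of _ T']) auto
  next
    case 3
    have new: "card (shadow T) = card (shadow (T - {m})) + card (quads m - shadow (T - {m}))"
      if "m \<in> T" for m
      unfolding shadow_remove[OF that]
      using card_Un_disjoint[of "shadow (T - {m})" "quads m - shadow (T - {m})"]
        finite_shadow[OF cubics_Diff[OF T]] by (simp add: Un_commute Diff_disjoint)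
    have replace: ?thesis
      if m: "m \<in> T" and n: "size n = 3" "set_mset n \<subseteq> set_mset m"
        and c: "card (shadow (T - {m})) + card (quads n - shadow (T - {m})) = a" for m n
    proof (intro exI[of _ "insert n (T - {m})"] conjI)
      show "cubics (insert n (T - {m}))" using cubics_Diff[OF T] n(1) by (rule cubics_insert)
      show "vars (insert n (T - {m})) \<subseteq> vars T" using n(2) vars_remove[OF m] by auto
      show "card (shadow (insert n (T - {m}))) = a"
        using card_Un_disjoint[of "shadow (T - {m})" "quads n - shadow (T - {m})"] c
        finite_shadow[OF cubics_Diff[OF T]] by (simp add: Un_commute Diff_disjoint)
      show "card (insert n (T - {m})) \<le> card T"
        using card.remove[OF fin m] fin by (simp add: card_insert_if)
    qed
    show ?thesis
    proof (cases "\<exists>m\<in>T. card (set_mset m) \<noteq> 3")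
      case True
      then obtain m where m: "m \<in> T" "card (set_mset m) \<noteq> 3" by blast
      have sz: "size m = 3" using m T by (simp add: cubics_def)
      \<comment> \<open>With a repeated variable there are at most two quadrics, whereas removing
        \<open>m\<close> loses at least two. So \<open>m\<close> has the form \<open>x^2 y\<close>
        with both quadrics private, and \<open>x^3\<close> contributes exactly the one that is
        wanted.\<close>
      have le: "card (quads m) \<le> 2" using card_quads[OF sz] card_set_mset_le[OF sz] m(2) by linarith
      have "card (quads m - shadow (T - {m})) \<le> card (quads m)" by (rule card_mono) auto
      then have two: "card (quads m - shadow (T - {m})) = 2" "card (quads m) = 2"
        and a: "a = Suc (card (shadow (T - {m})))"
        using 3(1) 3(2)[OF m(1)] new[OF m(1)] le by linarith+
      have priv: "quads m \<inter> shadow (T - {m}) = {}"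
        using two by (metis Diff_disjoint card_subset_eq Diff_subset finite_quads Int_commute)
      obtain x y where m': "m = {#x, x, y#}"
      proof -
        obtain x y z where xyz: "m = {#x, y, z#}" using sz by (rule size_3_cases)
        then have "x = y \<or> y = z \<or> x = z" using m(2)
          by (auto simp: card_insert_if split: if_splits)
        then show thesis using that xyz by (metis add_mset_commute)
      qed
      have "quads {#x, x, x#} - shadow (T - {m}) = {{#x, x#}}" using priv unfolding m' by auto
      then show ?thesis using replace[of m "{#x, x, x#}"] m(1) a by (simp add: m')
    next
      case False
      have "T \<noteq> {}" using 3(1) by (auto simp: shadow_def)
      then obtain m where m: "m \<in> T" by blast
      have sz: "size m = 3" using m T by (simp add: cubics_def)
      then obtain x y z where xyz: "m = {#x, y, z#}" by (rule size_3_cases)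
      have "card (set_mset m) = 3" using m False by blast
      then have dist: "x \<noteq> y" by (auto simp: xyz card_insert_if split: if_splits)
      \<comment> \<open>All cubics are squarefree here, so no square lies in the shadow:
        \<open>x^3\<close> contributes one quadric, and \<open>x^2 y\<close> contributes two if
        \<open>{#x, y#}\<close> is private.\<close>
      have sq: "{#x, x#} \<notin> shadow (T - {m})"
      proof
        assume "{#x, x#} \<in> shadow (T - {m})"
        then obtain w where "{#x, x, w#} \<in> T - {m}" using in_shadowE[OF cubics_Diff[OF T]] by metis
        then have "card (set_mset {#x, x, w#}) = 3" using False by blast
        then show False by (simp add: card_insert_if split: if_splits)
      qed
      have le: "card (quads m) \<le> 3" using sz by (rule card_quads_le)
      have le': "card (quads m - shadow (T - {m})) \<le> card (quads m)" by (rule card_mono) auto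
      consider "a = Suc (card (shadow (T - {m})))"
        | "a = Suc (Suc (card (shadow (T - {m}))))"
          "card (quads m - shadow (T - {m})) = card (quads m)"
        using 3(1) 3(2)[OF m] new[OF m] le le' by linarith
      then show ?thesis
      proof cases
        case 1
        have "quads {#x, x, x#} - shadow (T - {m}) = {{#x, x#}}" using sq by auto
        then show ?thesis using replace[of m "{#x, x, x#}"] m 1 by (simp add: xyz)
      next
        case 2
        have "quads m - shadow (T - {m}) = quads m"
          using 2(2) by (simp add: card_subset_eq)
        then have "quads {#x, x, y#} - shadow (T - {m}) = {{#x, x#}, {#x, y#}}"
          using sq unfolding xyz by auto
        then show ?thesis using replace[of m "{#x, x, y#}"] m 2 dist by (simp add: xyz)
      qed
    qed
  qed
qed

text \<open>
  If every cubic contributes at least as many variables as quadrics, then a quadric shared by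
  several cubics is a square \<open>x\<^sup>2\<close> of a shared variable; counting private and shared objects
  separately then gives at least as many variables as quadrics.
\<close>

lemma exists_few_sole_vars:
  assumes T: "cubics T" and irr: "irredundant T" and less: "card (vars T) < card (shadow T)"
  obtains m where "m \<in> T"
    "card (set_mset m - vars (T - {m})) < card (quads m - shadow (T - {m}))"
proof -
  define priv where "priv m = quads m - shadow (T - {m})" for m
  define sole where "sole m = set_mset m - vars (T - {m})" for m
  have fin: "finite T" using T by (simp add: cubics_def)
  have "\<exists>m\<in>T. card (sole m) < card (priv m)"
  proof (rule ccontr)
    assume "\<not> ?thesis"
    then have le: "card (priv m) \<le> card (sole m)" if "m \<in> T" for m using that by force
    let ?P = "\<Union>m\<in>T. priv m" and ?W = "\<Union>m\<in>T. sole m"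
    have "card ?P = (\<Sum>m\<in>T. card (priv m))"
      using fin by (intro card_UN_disjoint) (auto simp: priv_def shadow_def)
    also have "\<dots> \<le> (\<Sum>m\<in>T. card (sole m))" using le by (rule sum_mono)
    also have "\<dots> = card ?W"
      using fin by (intro card_UN_disjoint[symmetric]) (auto simp: sole_def vars_def)
    finally have PW: "card ?P \<le> card ?W" .
    have "shadow T - ?P \<subseteq> (\<lambda>x. {#x, x#}) ` (vars T - ?W)"
    proof
      fix q assume q: "q \<in> shadow T - ?P"
      then have "size q = 2" using in_shadow_size by blast
      then obtain x y where xy: "q = {#x, y#}" by (rule size_2_cases)
      then obtain z where m: "{#x, y, z#} \<in> T" using in_shadowE[OF T, of x y] q by auto
      let ?m = "{#x, y, z#}"
      have "q \<in> shadow (T - {?m})" using q m by (auto simp: priv_def xy)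
      then have xyV: "x \<in> vars (T - {?m})" "y \<in> vars (T - {?m})"
        using in_shadow_vars unfolding xy by fastforce+
      have "priv ?m \<noteq> {}" using irr m shadow_remove[OF m] by (auto simp: irredundant_def priv_def)
      then have "card (priv ?m) > 0" by (simp add: card_gt_0_iff priv_def)
      then have "card (sole ?m) > 0" using le[OF m] by linarith
      then have "sole ?m \<noteq> {}" by auto
      then have z: "sole ?m = {z}" using xyV by (auto simp: sole_def)
      then have zV: "z \<notin> vars (T - {?m})" by (auto simp: sole_def)
      then have "{#x, z#} \<notin> shadow (T - {?m})" "{#y, z#} \<notin> shadow (T - {?m})"
        using in_shadow_vars by fastforce+
      \<comment> \<open>With \<open>z\<close> as the single sole variable, \<open>?m\<close> has at
        most one private quadric, so these two coincide and the shared quadric \<open>q\<close> is a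
        square.\<close>
      then have "{{#x, z#}, {#y, z#}} \<subseteq> priv ?m" by (auto simp: priv_def)
      then have "card {{#x, z#}, {#y, z#}} \<le> card (priv ?m)"
        by (intro card_mono) (auto simp: priv_def)
      then have "x = y" using le[OF m] z by (auto simp: card_insert_if split: if_splits)
      moreover have "x \<notin> ?W"
      proof
        assume "x \<in> ?W"
        then obtain n where n: "n \<in> T" "x \<in> sole n" by blast
        have "x \<in> vars (T - {n})"
        proof (cases "n = ?m")
          case True
          then show ?thesis using xyV by simp
        next
          case False
          then have "?m \<in> T - {n}" using m by blast
          then show ?thesis unfolding vars_def by (rule UN_I) simp
        qed
        then show False using n by (simp add: sole_def)
      qed
      moreover have "x \<in> vars T" using xyV by (auto simp: vars_def)
      ultimately show "q \<in> (\<lambda>x. {#x, x#}) ` (vars T - ?W)" using xy by blast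
    qed
    then have QV: "card (shadow T - ?P) \<le> card (vars T - ?W)"
      using finite_vars[OF T] by (meson finite_Diff surj_card_le)
    have "?P \<subseteq> shadow T" "?W \<subseteq> vars T" by (auto simp: priv_def sole_def shadow_def vars_def)
    then have "card (shadow T) = card ?P + card (shadow T - ?P)"
      "card (vars T) = card ?W + card (vars T - ?W)"
      using finite_shadow[OF T] finite_vars[OF T]
      by (simp_all add: card_Diff_subset card_mono finite_subset)
    then show False using PW QV less by linarith
  qed
  then show thesis using that unfolding priv_def sole_def by blast
qed

text \<open>A cubic that contributes more quadrics than variables leaves room for one more new
  variable at the same number of quadrics.\<close>

lemma raise_vars_step:
  assumes T: "cubics T" and irr: "irredundant T" and less: "card (vars T) < card (shadow T)"
  obtains T' where "cubics T'" "card (vars T') = Suc (card (vars T))"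
    "card (shadow T') = card (shadow T)" "card T' \<le> card T"
proof -
  note outer = that
  obtain m where m: "m \<in> T"
    and lt: "card (set_mset m - vars (T - {m})) < card (quads m - shadow (T - {m}))"
    using exists_few_sole_vars[OF T irr less] .
  have fin: "finite T" using T by (simp add: cubics_def)
  \<comment> \<open>Replace \<open>m\<close>, which contributes \<open>s\<close> variables and \<open>k\<close> quadrics to the rest of \<open>T\<close>, by a cubic
    contributing \<open>s + 1\<close> variables and \<open>k\<close> quadrics.\<close>
  define T0 where "T0 = T - {m}"
  define s where "s = card (set_mset m - vars T0)"
  define k where "k = card (quads m - shadow T0)"
  have T0: "cubics T0" unfolding T0_def using T by (rule cubics_Diff)
  have sz: "size m = 3" using m T by (simp add: cubics_def)
  have sk: "s < k" using lt by (simp add: s_def k_def T0_def)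
  have "k \<le> card (quads m)" unfolding k_def by (rule card_mono) auto
  then have k3: "k \<le> 3" using card_quads_le[OF sz] by linarith
  have shadowU: "card (quads n \<union> shadow T0) = card (shadow T0) + card (quads n - shadow T0)" for n
    using card_Un_disjoint[of "shadow T0" "quads n - shadow T0"] finite_shadow[OF T0]
    by (simp add: Un_commute Diff_disjoint)
  have varsU: "card (set_mset n \<union> vars T0) = card (vars T0) + card (set_mset n - vars T0)" for n
    using card_Un_disjoint[of "vars T0" "set_mset n - vars T0"] finite_vars[OF T0]
    by (simp add: Un_commute Diff_disjoint)
  have result: thesis if "size n = 3" "card (set_mset n - vars T0) = Suc s"
    "card (quads n - shadow T0) = k" for n
  proof (rule outer[of "insert n T0"])
    show "cubics (insert n T0)" using T0 that(1) by (rule cubics_insert)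
    show "card (vars (insert n T0)) = Suc (card (vars T))"
      using varsU[of n] varsU[of m] that vars_remove[OF m] by (simp add: s_def T0_def)
    show "card (shadow (insert n T0)) = card (shadow T)"
      using shadowU[of n] shadowU[of m] that shadow_remove[OF m] by (simp add: k_def T0_def)
    show "card (insert n T0) \<le> card T"
      using card.remove[OF fin m] fin by (simp add: card_insert_if T0_def)
  qed
  obtain u where u: "u \<notin> vars T0"
    using ex_new_if_finite[OF infinite_UNIV_nat finite_vars[OF T0]] by metis
  obtain v where v: "v \<notin> insert u (vars T0)"
    using ex_new_if_finite[OF infinite_UNIV_nat, of "insert u (vars T0)"] finite_vars[OF T0] by auto
  obtain w where w: "w \<notin> insert v (insert u (vars T0))"
    using ex_new_if_finite[OF infinite_UNIV_nat, of "insert v (insert u (vars T0))"]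
      finite_vars[OF T0] by auto
  have fresh: "{#u, i#} \<notin> shadow T0" "{#v, i#} \<notin> shadow T0" "{#w, i#} \<notin> shadow T0" for i
    using in_shadow_vars u v w by fastforce+
  \<comment> \<open>If the remaining cubics had no variables, \<open>m\<close> would contribute all
    its variables and quadrics, which are equally many by \<open>card_quads\<close>; this
    contradicts \<open>s < k\<close>.\<close>
  have ne: "vars T0 \<noteq> {}"
  proof
    assume e: "vars T0 = {}"
    then have "shadow T0 = {}"
      by (metis in_shadow_size in_shadow_vars all_not_in_conv multiset_nonemptyE size_empty zero_neq_numeral)
    then show False using sk e card_quads[OF sz] by (simp add: s_def k_def)
  qed
  then obtain y where y: "y \<in> vars T0" by blast
  consider "s = 0" "k = 1" | "s = 1" "k = 2" | "s = 2" "k = 3" | "s = 0" "k = 2"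
    | "s = 1" "k = 3" | "s = 0" "k = 3" using sk k3 by linarith
  then show thesis
  proof cases
    case 1
    have "set_mset {#u, u, u#} - vars T0 = {u}" using u by auto
    moreover have "quads {#u, u, u#} - shadow T0 = {{#u, u#}}" using fresh by auto
    ultimately show thesis using result[of "{#u, u, u#}"] 1 by simp
  next
    case 2
    have "set_mset {#u, u, v#} - vars T0 = {u, v}" using u v by auto
    moreover have "quads {#u, u, v#} - shadow T0 = {{#u, u#}, {#u, v#}}" using fresh by auto
    ultimately show thesis using result[of "{#u, u, v#}"] 2 v by simp
  next
    case 3
    have "set_mset {#u, v, w#} - vars T0 = {u, v, w}" using u v w by auto
    moreover have "quads {#u, v, w#} - shadow T0 = {{#u, v#}, {#u, w#}, {#v, w#}}" using fresh by auto
    ultimately show thesis using result[of "{#u, v, w#}"] 3 v w by (simp add: add_eq_conv_ex)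
  next
    case 4
    have "u \<noteq> y" using u y by auto
    moreover have "set_mset {#u, u, y#} - vars T0 = {u}" using u y by auto
    moreover have "quads {#u, u, y#} - shadow T0 = {{#u, u#}, {#u, y#}}" using fresh by auto
    ultimately show thesis using result[of "{#u, u, y#}"] 4 by simp
  next
    case 5
    have "u \<noteq> y" "u \<noteq> v" "v \<noteq> y" using u v y by auto
    moreover have "set_mset {#u, v, y#} - vars T0 = {u, v}" using u v y by auto
    moreover have "quads {#u, v, y#} - shadow T0 = {{#u, v#}, {#u, y#}, {#v, y#}}" using fresh by auto
    ultimately show thesis using result[of "{#u, v, y#}"] 5 by (simp add: add_eq_conv_ex)
  next
    case 6
    \<comment> \<open>Three new quadrics with one fresh variable require two old variables whose
      product is new. The pair \<open>b\<close>, \<open>c\<close> from \<open>m\<close> serves,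
      since all quadrics of \<open>m\<close> are private and all its variables occur in
      \<open>T0\<close>.\<close>
    obtain a b c where abc: "m = {#a, b, c#}" using sz by (rule size_3_cases)
    have "card (quads m) = 3" using \<open>k \<le> card (quads m)\<close> card_quads_le[OF sz] 6 by linarith
    then have "b \<noteq> c" using card_quads[OF sz] by (auto simp: abc card_insert_if split: if_splits)
    have "quads m - shadow T0 = quads m"
      using 6 \<open>card (quads m) = 3\<close> by (simp add: card_subset_eq k_def)
    then have "{#b, c#} \<notin> shadow T0" by (auto simp: abc)
    have "set_mset m - vars T0 = {}" using 6 by (simp add: s_def)
    then have "b \<in> vars T0" "c \<in> vars T0" by (auto simp: abc)
    then have "u \<noteq> b" "u \<noteq> c" using u by auto
    moreover have "set_mset {#u, b, c#} - vars T0 = {u}" using u \<open>b \<in> vars T0\<close> \<open>c \<in> vars T0\<close> by auto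
    moreover have "quads {#u, b, c#} - shadow T0 = {{#u, b#}, {#u, c#}, {#b, c#}}"
      using fresh \<open>{#b, c#} \<notin> shadow T0\<close> by auto
    ultimately show thesis using result[of "{#u, b, c#}"] 6 \<open>b \<noteq> c\<close> by (simp add: add_eq_conv_ex)
  qed
qed

text \<open>Iterates \<open>raise_vars_step\<close>, discarding redundant cubics in between to
  restore its irredundancy hypothesis.\<close>

lemma raise_vars:
  assumes "cubics T" "card (vars T) \<le> r" "r \<le> card (shadow T)"
  shows "\<exists>T'. cubics T' \<and> card (vars T') = r \<and> card (shadow T') = card (shadow T) \<and> card T' \<le> card T"
  using assms
proof (induction "r - card (vars T) + card T" arbitrary: T rule: less_induct)
  case less
  note T = \<open>cubics T\<close>
  consider "card (vars T) = r" | m where "m \<in> T" "shadow (T - {m}) = shadow T"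
    | "card (vars T) < r" "irredundant T"
    using less.prems(2) by (metis irredundant_def le_neq_implies_less)
  then show ?case
  proof cases
    case 1
    then show ?thesis using T by blast
  next
    case (2 m)
    have c: "cubics (T - {m})" using T by (rule cubics_Diff)
    have "finite T" using T by (simp add: cubics_def)
    then have lt: "card (T - {m}) < card T" using 2(1) by (rule card_Diff1_less)
    moreover have "vars (T - {m}) = vars T" using vars_eqI[OF c T 2(2)] .
    ultimately have "\<exists>T'. cubics T' \<and> card (vars T') = r \<and> card (shadow T') = card (shadow T)
      \<and> card T' \<le> card (T - {m})"
      using less.hyps[of "T - {m}"] less.prems c 2(2) by simp
    then show ?thesis using lt less_imp_le order_trans by metis
  next
    case 3
    then have "card (vars T) < card (shadow T)" using less.prems(3) by linarith
    then obtain T' where T': "cubics T'" "card (vars T') = Suc (card (vars T))"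
      "card (shadow T') = card (shadow T)" "card T' \<le> card T"
      using raise_vars_step[OF T 3(2)] by metis
    then have "r - card (vars T') + card T' < r - card (vars T) + card T" using 3(1) by linarith
    then have "\<exists>T''. cubics T'' \<and> card (vars T'') = r \<and> card (shadow T'') = card (shadow T)
      \<and> card T'' \<le> card T'"
      using less.hyps[of T'] less.prems T' 3(1) by simp
    then show ?thesis using T'(4) order_trans by metis
  qed
qed

text \<open>The order of the three moves matters. Lowering the quadrics may lose variables, which
  are then raised to \<open>r\<close>; neither move increases the number of cubics, so
  \<open>raise_card\<close> can finally reach \<open>b\<close>.\<close>

lemma realizable_low:
  assumes "cubics T" "card (vars T) \<le> r" "a \<le> card (shadow T)" "card T \<le> b"
    and "r \<le> a" "b \<le> a"
  shows "realizable r a b"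
proof -
  obtain T1 where T1: "cubics T1" "vars T1 \<subseteq> vars T" "card (shadow T1) = a" "card T1 \<le> card T"
    using reduce_shadow[OF assms(1,3)] by blast
  have "card (vars T1) \<le> r"
    using T1(2) assms(1,2) by (meson card_mono finite_vars order_trans)
  then obtain T2 where T2: "cubics T2" "card (vars T2) = r" "card (shadow T2) = a" "card T2 \<le> card T1"
    using raise_vars[OF T1(1), of r] T1(3) assms(5) by auto
  then show ?thesis
    using raise_card[OF T2(1), of b] T1(4) assms(4,6) unfolding realizable_def by auto
qed

subsection \<open>Triangles in graphs\<close>

definition graph_on :: "nat set \<Rightarrow> nat set set \<Rightarrow> bool" where
  "graph_on V E \<longleftrightarrow> finite V \<and> (\<forall>e\<in>E. e \<subseteq> V \<and> card e = 2)"

definition triangles :: "nat set set \<Rightarrow> nat set set" where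
  "triangles E = {t. card t = 3 \<and> (\<forall>e. e \<subseteq> t \<and> card e = 2 \<longrightarrow> e \<in> E)}"

lemma finite_edges: "graph_on V E \<Longrightarrow> finite E"
  by (rule finite_subset[of E "Pow V"]) (auto simp: graph_on_def)

lemma card_edges_le:
  assumes "graph_on V E"
  shows "card E \<le> card V choose 2"
proof -
  have "finite V" using assms by (simp add: graph_on_def)
  moreover have "card E \<le> card {e. e \<subseteq> V \<and> card e = 2}"
    using assms \<open>finite V\<close> by (intro card_mono) (auto simp: graph_on_def)
  ultimately show ?thesis by (simp add: n_subsets)
qed

lemma finite_triangle: "t \<in> triangles E \<Longrightarrow> finite t"
  by (rule card_ge_0_finite) (simp add: triangles_def)

lemma triangles_subset:
  assumes "graph_on V E" "t \<in> triangles E"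
  shows "t \<subseteq> V"
proof
  fix x assume x: "x \<in> t"
  have "card (t - {x}) = 2" using assms(2) x by (simp add: triangles_def)
  then have "t - {x} \<noteq> {}" by (metis card.empty zero_neq_numeral)
  then obtain y where "y \<in> t - {x}" by blast
  then have "{x, y} \<in> E" using assms(2) x by (auto simp: triangles_def)
  then show "x \<in> V" using assms(1) by (auto simp: graph_on_def)
qed

lemma finite_triangles:
  assumes "graph_on V E"
  shows "finite (triangles E)"
proof (rule finite_subset)
  show "triangles E \<subseteq> Pow V" using triangles_subset[OF assms] by blast
  show "finite (Pow V)" using assms by (simp add: graph_on_def)
qed

lemma triangles_mono: "E \<subseteq> F \<Longrightarrow> triangles E \<subseteq> triangles F"
  unfolding triangles_def by blast

text \<open>The shift operator of the Kruskal--Katona theorem.\<close>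

definition move :: "nat \<Rightarrow> nat \<Rightarrow> nat set set \<Rightarrow> nat set \<Rightarrow> nat set" where
  "move v w S e = (if v \<in> e \<and> w \<notin> e \<and> insert w (e - {v}) \<notin> S then insert w (e - {v}) else e)"

text \<open>A set moves only to a place outside \<open>S\<close>, so it cannot collide with a set
  that stays; two moved sets are recovered by exchanging \<open>w\<close> for \<open>v\<close>
  again.\<close>

lemma inj_on_move:
  shows "inj_on (move v w S) S"
proof (rule inj_onI)
  fix e f assume ef: "e \<in> S" "f \<in> S" "move v w S e = move v w S f"
  have "e = f" if "v \<in> e" "w \<notin> e" "v \<in> f" "w \<notin> f" "insert w (e - {v}) = insert w (f - {v})"
  proof -
    have "e = insert v (insert w (e - {v}) - {w})" "f = insert v (insert w (f - {v}) - {w})"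
      using that by auto
    then show ?thesis using that(5) by simp
  qed
  then show "e = f" using ef by (auto simp: move_def split: if_splits)
qed

lemma card_move: "finite e \<Longrightarrow> card (move v w S e) = card e"
  by (auto simp: move_def card_gt_0_iff intro!: Suc_pred)

text \<open>Each edge of a moved triangle either was an edge without \<open>v\<close>, which stays,
  or is the image of an edge of the old triangle. A triangle that contains \<open>v\<close> and
  stays either contains \<open>w\<close> or has its shifted copy already present; in both cases the
  targets of its edges at \<open>v\<close> are occupied, so these edges stay too.\<close>

lemma move_triangles:
  assumes "v \<noteq> w"
  shows "move v w (triangles E) ` triangles E \<subseteq> triangles (move v w E ` E)"
proof
  fix t' assume "t' \<in> move v w (triangles E) ` triangles E"
  then obtain t where t: "t \<in> triangles E" and t': "t' = move v w (triangles E) t" by blast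
  have card: "card t' = 3" using t card_move[OF finite_triangle[OF t]] by (simp add: t' triangles_def)
  have edge: "e \<in> E" if "s \<in> triangles E" "e \<subseteq> s" "card e = 2" for e s
    using that by (simp add: triangles_def)
  have "e \<in> move v w E ` E" if e: "e \<subseteq> t'" "card e = 2" for e
  proof (cases "v \<in> t \<and> w \<notin> t \<and> insert w (t - {v}) \<notin> triangles E")
    case True
    then have t'_eq: "t' = insert w (t - {v})" by (simp add: t' move_def)
    show ?thesis
    proof (cases "w \<in> e \<and> e \<notin> E")
      case w: True
      define f where "f = insert v (e - {w})"
      have "finite e" using e(2) by (metis card.infinite zero_neq_numeral)
      have "v \<notin> e" using e(1) t'_eq \<open>v \<noteq> w\<close> by auto
      then have "card f = 2" using w e(2) \<open>finite e\<close> by (simp add: f_def card_Diff_singleton)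
      moreover have "f \<subseteq> t" using e(1) True by (auto simp: f_def t'_eq)
      ultimately have "f \<in> E" using edge[OF t] by blast
      moreover have "insert w (f - {v}) = e" using w \<open>v \<notin> e\<close> by (auto simp: f_def)
      then have "move v w E f = e" using w \<open>v \<noteq> w\<close> by (auto simp: move_def f_def)
      ultimately show ?thesis by blast
    next
      case False
      have "e \<in> E"
      proof (cases "w \<in> e")
        case False
        then have "e \<subseteq> t" using e(1) t'_eq by auto
        then show ?thesis using edge[OF t] e(2) by blast
      qed (use False in blast)
      moreover have "v \<notin> e" using e(1) t'_eq \<open>v \<noteq> w\<close> by auto
      then have "move v w E e = e" by (simp add: move_def)
      ultimately show ?thesis by force
    qed
  next
    case False
    then have "t' = t" by (auto simp: t' move_def)
    then have "e \<in> E" using edge[OF t] e by blast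
    have "insert w (e - {v}) \<in> E" if "v \<in> e" "w \<notin> e"
    proof -
      have "finite e" using e(2) by (metis card.infinite zero_neq_numeral)
      then have "card (insert w (e - {v})) = 2" using that e(2) by (simp add: card_Diff_singleton)
      moreover have "insert w (e - {v}) \<subseteq> t \<or>
        insert w (t - {v}) \<in> triangles E \<and> insert w (e - {v}) \<subseteq> insert w (t - {v})"
        using False that e(1) \<open>t' = t\<close> by auto
      ultimately show ?thesis using edge t by blast
    qed
    then have "move v w E e = e" by (auto simp: move_def)
    then show ?thesis using \<open>e \<in> E\<close> by force
  qed
  then show "t' \<in> triangles (move v w E ` E)" using card by (simp add: triangles_def)
qed

text \<open>The vertices in \<open>D\<close> are joined to all others, so every missing edge avoids
  \<open>D\<close> and closes a new triangle with each vertex of \<open>D\<close>.\<close>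

lemma add_edges:
  assumes E: "graph_on V E" and D: "D \<subseteq> V"
    and adj: "\<And>x y. x \<in> V \<Longrightarrow> y \<in> D \<Longrightarrow> x \<noteq> y \<Longrightarrow> {x, y} \<in> E"
    and le: "card E + k \<le> card V choose 2"
  shows "\<exists>E'. graph_on V E' \<and> E \<subseteq> E' \<and> card E' = card E + k \<and>
    card (triangles E) + k * card D \<le> card (triangles E')"
  using le
proof (induction k)
  case 0
  then show ?case using E by auto
next
  case (Suc k)
  then obtain E' where E': "graph_on V E'" "E \<subseteq> E'" "card E' = card E + k"
    "card (triangles E) + k * card D \<le> card (triangles E')" by auto
  have "card {e. e \<subseteq> V \<and> card e = 2} = card V choose 2"
    using E n_subsets by (auto simp: graph_on_def)
  then have "E' \<noteq> {e. e \<subseteq> V \<and> card e = 2}" using Suc.prems E'(3) by auto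
  moreover have "E' \<subseteq> {e. e \<subseteq> V \<and> card e = 2}" using E'(1) by (auto simp: graph_on_def)
  ultimately obtain e where e: "e \<notin> E'" "e \<subseteq> V" "card e = 2" by blast
  then obtain x y where xy: "e = {x, y}" "x \<noteq> y" by (meson card_2_iff)
  let ?F = "insert e E'"
  have F: "graph_on V ?F" using E'(1) e by (auto simp: graph_on_def)
  have notD: "x \<notin> D" "y \<notin> D"
    using adj[of y x] adj[of x y] e xy E'(2) by (auto simp: insert_commute)
  have new: "(\<lambda>z. {x, y, z}) ` D \<subseteq> triangles ?F - triangles E'"
  proof
    fix t assume "t \<in> (\<lambda>z. {x, y, z}) ` D"
    then obtain z where z: "z \<in> D" and t: "t = {x, y, z}" by blast
    have zn: "z \<noteq> x" "z \<noteq> y" using z notD by auto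
    have xz: "{x, z} \<in> E'" "{y, z} \<in> E'" using adj[of x z] adj[of y z] z zn e xy E'(2) by auto
    have "f \<in> ?F" if f: "f \<subseteq> t" "card f = 2" for f
    proof -
      obtain a b where "f = {a, b}" "a \<noteq> b" using f(2) by (meson card_2_iff)
      then show ?thesis using f(1) xz xy by (auto simp: t insert_commute)
    qed
    moreover have "card t = 3" using zn xy by (simp add: t)
    ultimately have "t \<in> triangles ?F" by (simp add: triangles_def)
    moreover have "e \<subseteq> t" by (simp add: t xy)
    then have "t \<notin> triangles E'" using e unfolding triangles_def by blast
    ultimately show "t \<in> triangles ?F - triangles E'" by blast
  qed
  have "inj_on (\<lambda>z. {x, y, z}) D"
  proof (rule inj_onI)
    fix z z' assume "z \<in> D" "z' \<in> D" "{x, y, z} = {x, y, z'}"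
    then have "z \<in> {x, y, z'}" by blast
    then show "z = z'" using \<open>z \<in> D\<close> notD by blast
  qed
  then have "card ((\<lambda>z. {x, y, z}) ` D) = card D" by (rule card_image)
  then have "card D \<le> card (triangles ?F - triangles E')"
    using new finite_triangles[OF F] by (metis card_mono finite_Diff)
  moreover have "triangles E' \<subseteq> triangles ?F" by (rule triangles_mono) auto
  ultimately have "card (triangles E') + card D \<le> card (triangles ?F)"
    using finite_triangles[OF F] finite_triangles[OF E'(1)] card_mono[of "triangles ?F" "triangles E'"]
    by (simp add: card_Diff_subset)
  moreover have "card ?F = card E + Suc k" using E'(3) e finite_edges[OF E'(1)] by simp
  ultimately show ?case using F E'(2,4) by (intro exI[of _ ?F]) auto
qed

text \<open>While some neighbour of \<open>v\<close> is not adjacent to some other vertex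
  \<open>w\<close>, shifting from \<open>v\<close> to \<open>w\<close> lowers the degree of
  \<open>v\<close> without losing edges or triangles. Otherwise, for \<open>d\<close> neighbours,
  deleting \<open>v\<close> costs at most \<open>d choose 2\<close> triangles, while the
  \<open>d + 1\<close> edges then added create at least \<open>(d + 1) * d\<close>.\<close>

lemma delete_vertex:
  assumes "graph_on V E" "v \<in> V" "Suc (card E) \<le> (card V - 1) choose 2"
  shows "\<exists>E'. graph_on (V - {v}) E' \<and> card E' = Suc (card E) \<and>
    card (triangles E) \<le> card (triangles E')"
  using assms
proof (induction "card {e \<in> E. v \<in> e}" arbitrary: E rule: less_induct)
  case less
  note E = \<open>graph_on V E\<close>
  have finV: "finite V" using E by (simp add: graph_on_def)
  show ?case
  proof (cases "\<exists>w y. w \<in> V \<and> w \<noteq> v \<and> {v, y} \<in> E \<and> y \<noteq> w \<and> {w, y} \<notin> E")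
    case True
    then obtain w y where w: "w \<in> V" "w \<noteq> v" and y: "{v, y} \<in> E" "y \<noteq> w" "{w, y} \<notin> E" by blast
    let ?E = "move v w E ` E"
    have fine: "finite e" if "e \<in> E" for e
      using that E finV by (meson finite_subset graph_on_def)
    have g: "graph_on V ?E"
      unfolding graph_on_def
    proof (intro conjI ballI finV)
      fix e assume "e \<in> ?E"
      then obtain f where f: "f \<in> E" "e = move v w E f" by blast
      then show "card e = 2" using card_move[OF fine] E by (simp add: graph_on_def)
      have "f \<subseteq> V" using f E by (simp add: graph_on_def)
      then show "e \<subseteq> V" using f w by (auto simp: move_def)
    qed
    have card: "card ?E = card E" using inj_on_move by (rule card_image)
    have "card (triangles E) = card (move v w (triangles E) ` triangles E)"
      using inj_on_move by (rule card_image[symmetric])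
    also have "\<dots> \<le> card (triangles ?E)"
      using w by (intro card_mono finite_triangles[OF g] move_triangles) auto
    finally have tri: "card (triangles E) \<le> card (triangles ?E)" .
    have "y \<noteq> v" using y(1) E by (auto simp: graph_on_def)
    \<comment> \<open>A moved edge no longer contains \<open>v\<close>, so the edges at
      \<open>v\<close> after the shift are old edges that stayed.\<close>
    have fixed: "e \<in> E \<and> move v w E e = e" if "e \<in> ?E" "v \<in> e" for e
    proof -
      obtain f where "f \<in> E" "e = move v w E f" using \<open>e \<in> ?E\<close> by blast
      moreover then have "e = f" using w \<open>v \<in> e\<close> by (auto simp: move_def split: if_splits)
      ultimately show ?thesis by simp
    qed
    have "insert w ({v, y} - {v}) = {w, y}" using \<open>y \<noteq> v\<close> by auto
    then have "move v w E {v, y} = {w, y}" using w y by (simp add: move_def)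
    moreover have "{w, y} \<noteq> {v, y}" using w \<open>y \<noteq> v\<close> by (simp add: doubleton_eq_iff)
    ultimately have "{v, y} \<notin> ?E" using fixed[of "{v, y}"] by auto
    moreover have "{e \<in> ?E. v \<in> e} \<subseteq> {e \<in> E. v \<in> e}" using fixed by blast
    ultimately have "{e \<in> ?E. v \<in> e} \<subset> {e \<in> E. v \<in> e}" using y(1) by blast
    then have "card {e \<in> ?E. v \<in> e} < card {e \<in> E. v \<in> e}"
      using finite_edges[OF E] by (intro psubset_card_mono) auto
    then show ?thesis using less.hyps[of ?E] g card tri less.prems by fastforce
  next
    case False
    \<comment> \<open>All neighbours of \<open>v\<close> are adjacent to every other vertex, so each edge added to
      \<open>V - {v}\<close> closes a triangle with every one of them.\<close>
    define D where "D = {y. {v, y} \<in> E}"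
    define E0 where "E0 = {e \<in> E. v \<notin> e}"
    have DV: "D \<subseteq> V - {v}" using E by (auto simp: D_def graph_on_def)
    have g0: "graph_on (V - {v}) E0" using E by (auto simp: graph_on_def E0_def)
    have adj: "{x, y} \<in> E0" if "x \<in> V - {v}" "y \<in> D" "x \<noteq> y" for x y
      using that False DV by (auto simp: D_def E0_def)
    have inj: "inj_on (\<lambda>y. {v, y}) D" using DV by (auto simp: inj_on_def doubleton_eq_iff)
    have "E = E0 \<union> (\<lambda>y. {v, y}) ` D"
    proof (intro equalityI subsetI)
      fix e assume e: "e \<in> E"
      show "e \<in> E0 \<union> (\<lambda>y. {v, y}) ` D"
      proof (cases "v \<in> e")
        case True
        have "card e = 2" using e E by (simp add: graph_on_def)
        then obtain a b where "e = {a, b}" by (meson card_2_iff)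
        then have "e = {v, a} \<or> e = {v, b}" using True by auto
        then show ?thesis using e by (auto simp: D_def)
      qed (use e in \<open>simp add: E0_def\<close>)
    qed (auto simp: D_def E0_def)
    moreover have "finite D" using DV finV by (auto intro: finite_subset)
    moreover have "E0 \<inter> (\<lambda>y. {v, y}) ` D = {}" by (auto simp: E0_def)
    ultimately have cE: "card E = card E0 + card D"
      using finite_edges[OF g0] card_image[OF inj] by (metis card_Un_disjoint finite_imageI)
    have "card E0 + Suc (card D) \<le> card (V - {v}) choose 2"
      using cE less.prems(2,3) finV by (simp add: card_Diff_singleton)
    then obtain E' where E': "graph_on (V - {v}) E'" "card E' = card E0 + Suc (card D)"
      "card (triangles E0) + Suc (card D) * card D \<le> card (triangles E')"
      using add_edges[OF g0 DV adj] by blast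
    have "triangles E \<subseteq> triangles E0 \<union> insert v ` {p. p \<subseteq> D \<and> card p = 2}"
    proof
      fix t assume t: "t \<in> triangles E"
      show "t \<in> triangles E0 \<union> insert v ` {p. p \<subseteq> D \<and> card p = 2}"
      proof (cases "v \<in> t")
        case True
        have "t - {v} \<subseteq> D" using t True by (auto simp: triangles_def D_def)
        moreover have "card (t - {v}) = 2" using t True by (simp add: triangles_def)
        ultimately show ?thesis using True by (auto intro!: image_eqI[of _ _ "t - {v}"])
      next
        case False
        then show ?thesis using t by (auto simp: triangles_def E0_def)
      qed
    qed
    moreover have finP: "finite {p. p \<subseteq> D \<and> card p = 2}"
      using \<open>finite D\<close> by simp
    ultimately have "card (triangles E) \<le>
      card (triangles E0) + card (insert v ` {p. p \<subseteq> D \<and> card p = 2})"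
      using finite_triangles[OF g0]
      by (meson card_Un_le card_mono finite_UnI finite_imageI order_trans)
    also have "card (insert v ` {p. p \<subseteq> D \<and> card p = 2}) \<le> card {p. p \<subseteq> D \<and> card p = 2}"
      using finP by (rule card_image_le)
    also have "\<dots> = card D choose 2" using \<open>finite D\<close> by (rule n_subsets)
    also have "\<dots> \<le> Suc (card D) * card D"
      unfolding choose_two by (rule order_trans[OF div_le_dividend]) (simp add: algebra_simps)
    finally show ?thesis using E' cE by auto
  qed
qed

subsection \<open>From sets of cubics to graphs\<close>

lemma distinct_representatives_cubic:
  assumes "size m = 3"
  shows "\<exists>\<psi>. inj_on \<psi> (set_mset m) \<and> (\<forall>x\<in>set_mset m. x \<in># \<psi> x \<and> \<psi> x \<in> quads m)"
proof -
  obtain x y z where m: "m = {#x, y, z#}" using assms by (rule size_3_cases)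
  consider "x = y" "y = z" | a b where "a \<noteq> b" "m = {#a, a, b#}"
    | "x \<noteq> y" "y \<noteq> z" "x \<noteq> z"
    using m add_mset_commute by metis
  then show ?thesis
  proof cases
    case 1
    then show ?thesis by (intro exI[of _ "\<lambda>_. {#x, x#}"]) (simp add: m)
  next
    case 2
    then show ?thesis
      by (intro exI[of _ "\<lambda>u. if u = a then {#a, a#} else {#a, b#}"]) (auto simp: inj_on_def)
  next
    case 3
    then show ?thesis
      by (intro exI[of _ "\<lambda>u. if u = x then {#x, y#} else if u = y then {#y, z#} else {#x, z#}"])
        (auto simp: inj_on_def m add_eq_conv_ex)
  qed
qed

text \<open>Adding a cubic, old variables keep their representatives and only new variables use
  those supplied by the cubic.\<close>

lemma distinct_representatives:
  assumes "cubics T"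
  shows "\<exists>\<phi>. inj_on \<phi> (vars T) \<and> (\<forall>x\<in>vars T. x \<in># \<phi> x \<and> \<phi> x \<in> shadow T)"
proof -
  have "finite T" "\<forall>m\<in>T. size m = 3" using assms by (simp_all add: cubics_def)
  then show ?thesis
  proof (induction T rule: finite_induct)
    case empty
    then show ?case by (simp add: vars_def)
  next
    case (insert m T)
    then obtain \<phi> where \<phi>: "inj_on \<phi> (vars T)" "\<And>x. x \<in> vars T \<Longrightarrow> x \<in># \<phi> x \<and> \<phi> x \<in> shadow T"
      by auto
    obtain \<psi> where \<psi>: "inj_on \<psi> (set_mset m)" "\<And>x. x \<in># m \<Longrightarrow> x \<in># \<psi> x \<and> \<psi> x \<in> quads m"
      using distinct_representatives_cubic[of m] insert.prems by auto
    define \<chi> where "\<chi> x = (if x \<in> vars T then \<phi> x else \<psi> x)" for x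
    \<comment> \<open>The representative of a new variable contains that variable, so it is outside
      the old shadow.\<close>
    have ne: "\<phi> x \<noteq> \<psi> y" if "x \<in> vars T" "y \<in># m" "y \<notin> vars T" for x y
      using \<phi>(2)[OF that(1)] \<psi>(2)[OF that(2)] that(3) in_shadow_vars by metis
    have "inj_on \<chi> (vars (insert m T))"
    proof (rule inj_onI)
      fix x y assume "x \<in> vars (insert m T)" "y \<in> vars (insert m T)" "\<chi> x = \<chi> y"
      then show "x = y"
        using \<phi>(1) \<psi>(1) ne[of x y] ne[of y x] unfolding \<chi>_def inj_on_def
        by (auto split: if_splits)
    qed
    moreover have "\<forall>x\<in>vars (insert m T). x \<in># \<chi> x \<and> \<chi> x \<in> shadow (insert m T)"
      using \<phi>(2) \<psi>(2) by (auto simp: \<chi>_def)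
    ultimately show ?case by blast
  qed
qed

lemma card_vars_le_card_shadow:
  assumes "cubics T"
  shows "card (vars T) \<le> card (shadow T)"
proof -
  obtain \<phi> where "inj_on \<phi> (vars T)" "\<forall>x\<in>vars T. x \<in># \<phi> x \<and> \<phi> x \<in> shadow T"
    using distinct_representatives[OF assms] by blast
  then show ?thesis using finite_shadow[OF assms] by (intro card_inj_on_le[of \<phi>]) auto
qed

text \<open>The cubics lost are the multiples \<open>xyz\<close> of the dropped quadric. They are
  sent injectively to multiples of \<open>x^2\<close>, none of which lay over
  \<open>Q\<close>.\<close>

lemma cubics_over_square_swap:
  assumes fin: "finite Q" and "x \<noteq> y" and xy: "{#x, y#} \<in> Q" and xx: "{#x, x#} \<notin> Q"
  shows "card (cubics_over Q) \<le> card (cubics_over (insert {#x, x#} (Q - {{#x, y#}})))"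
proof -
  let ?Q = "insert {#x, x#} (Q - {{#x, y#}})"
  let ?A = "cubics_over Q" and ?B = "cubics_over ?Q"
  define Z where "Z = {z. {#x, y, z#} \<in> ?A}"
  \<comment> \<open>The natural image \<open>x^2 z\<close> fails for \<open>z = y\<close>, where it
    would still use \<open>{#x, y#}\<close>. Then \<open>x^3\<close> replaces it, which is free
    because \<open>z = x\<close> never occurs in \<open>Z\<close>.\<close>
  define g where "g z = (if z = y then x else z)" for z
  have finA: "finite ?A" and finB: "finite ?B" using fin by (simp_all add: finite_cubics_over)
  have zx: "z \<noteq> x" and xz: "{#x, z#} \<in> Q" if "z \<in> Z" for z
    using that xx by (auto simp: Z_def cubics_over_def)
  have "inj_on (\<lambda>z. {#x, y, z#}) Z" by (simp add: inj_on_def)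
  moreover have "(\<lambda>z. {#x, y, z#}) ` Z \<subseteq> ?A" by (auto simp: Z_def)
  ultimately have finZ: "finite Z" using finA by (meson finite_imageD finite_subset)
  have "?A \<subseteq> (?A \<inter> ?B) \<union> (\<lambda>z. {#x, y, z#}) ` Z"
  proof
    fix c assume c: "c \<in> ?A"
    show "c \<in> (?A \<inter> ?B) \<union> (\<lambda>z. {#x, y, z#}) ` Z"
    proof (cases "c \<in> ?B")
      case False
      then have "{#x, y#} \<in> quads c" and sz: "size c = 3" using c by (auto simp: cubics_over_def)
      then obtain z where "c = {#x, y, z#}" using size_3_quads_cases by metis
      then show ?thesis using c by (auto simp: Z_def)
    qed (use c in blast)
  qed
  then have "card ?A \<le> card ((?A \<inter> ?B) \<union> (\<lambda>z. {#x, y, z#}) ` Z)"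
    using finA finZ by (intro card_mono) auto
  also have "\<dots> \<le> card (?A \<inter> ?B) + card ((\<lambda>z. {#x, y, z#}) ` Z)" by (rule card_Un_le)
  also have "\<dots> \<le> card (?A \<inter> ?B) + card Z" using finZ card_image_le by auto
  also have "card Z = card ((\<lambda>z. {#x, x, g z#}) ` Z)"
    using zx by (intro card_image[symmetric]) (auto simp: inj_on_def g_def split: if_splits)
  also have "card (?A \<inter> ?B) + \<dots> = card ((?A \<inter> ?B) \<union> (\<lambda>z. {#x, x, g z#}) ` Z)"
    using finA finZ xx by (intro card_Un_disjoint[symmetric]) (auto simp: cubics_over_def)
  also have "\<dots> \<le> card ?B"
  proof (rule card_mono[OF finB])
    have "{#x, x, g z#} \<in> ?B" if "z \<in> Z" for z
      using xz[OF that] zx[OF that] by (auto simp: cubics_over_def g_def)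
    then show "(?A \<inter> ?B) \<union> (\<lambda>z. {#x, x, g z#}) ` Z \<subseteq> ?B" by auto
  qed
  finally show ?thesis .
qed

text \<open>A missing \<open>x^2\<close> replaces the representative of \<open>x\<close>. Since
  representatives are distinct, those of the other variables survive, so the exchange can be
  repeated for every variable.\<close>

lemma all_squares:
  assumes "finite W" "finite Q" "\<And>q. q \<in> Q \<Longrightarrow> size q = 2 \<and> set_mset q \<subseteq> W"
    and "inj_on \<phi> W" "\<And>x. x \<in> W \<Longrightarrow> x \<in># \<phi> x \<and> \<phi> x \<in> Q"
  shows "\<exists>Q'. finite Q' \<and> (\<forall>q\<in>Q'. size q = 2 \<and> set_mset q \<subseteq> W) \<and> (\<forall>x\<in>W. {#x, x#} \<in> Q') \<and>
    card Q' = card Q \<and> card (cubics_over Q) \<le> card (cubics_over Q')"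
  using assms
proof (induction "card {x \<in> W. {#x, x#} \<notin> Q}" arbitrary: Q \<phi> rule: less_induct)
  case less
  show ?case
  proof (cases "\<forall>x\<in>W. {#x, x#} \<in> Q")
    case True
    then show ?thesis using less.prems by (intro exI[of _ Q]) auto
  next
    case False
    then obtain x where x: "x \<in> W" "{#x, x#} \<notin> Q" by blast
    have "x \<in># \<phi> x" and Q: "\<phi> x \<in> Q" and "size (\<phi> x) = 2" using x less.prems(3,5) by auto
    then obtain y where y: "\<phi> x = {#x, y#}"
      by (metis insert_DiffM size_Diff_singleton diff_Suc_1 numeral_2_eq_2 size_1_singleton_mset One_nat_def)
    then have "x \<noteq> y" using x Q by auto
    let ?Q = "insert {#x, x#} (Q - {{#x, y#}})"
    let ?\<phi> = "\<phi>(x := {#x, x#})"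
    have "{#u, u#} \<noteq> {#x, y#}" for u using \<open>x \<noteq> y\<close> by (simp add: add_eq_conv_ex)
    then have "{u \<in> W. {#u, u#} \<notin> ?Q} \<subseteq> {u \<in> W. {#u, u#} \<notin> Q} - {x}" by auto
    then have "{u \<in> W. {#u, u#} \<notin> ?Q} \<subset> {u \<in> W. {#u, u#} \<notin> Q}" using x by blast
    then have lt: "card {u \<in> W. {#u, u#} \<notin> ?Q} < card {u \<in> W. {#u, u#} \<notin> Q}"
      using less.prems(1) by (intro psubset_card_mono) auto
    have other: "\<phi> u \<noteq> {#x, y#}" "\<phi> u \<noteq> {#x, x#}" if "u \<in> W" "u \<noteq> x" for u
    proof -
      show "\<phi> u \<noteq> {#x, y#}" using that x(1) y less.prems(4) by (metis inj_onD)
      show "\<phi> u \<noteq> {#x, x#}" using that(1) x(2) less.prems(5) by metis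
    qed
    have "inj_on ?\<phi> W"
    proof (rule inj_onI)
      fix u v assume uv: "u \<in> W" "v \<in> W" "?\<phi> u = ?\<phi> v"
      then show "u = v"
        using other(2)[of u] other(2)[of v] inj_onD[OF less.prems(4), of u v]
        by (cases "u = x"; cases "v = x") simp_all
    qed
    moreover have "u \<in># ?\<phi> u \<and> ?\<phi> u \<in> ?Q" if "u \<in> W" for u
      using that other[of u] less.prems(5)[of u] by auto
    moreover have "size q = 2 \<and> set_mset q \<subseteq> W" if "q \<in> ?Q" for q
      using that x less.prems(3) by auto
    ultimately obtain Q' where Q': "finite Q'" "\<forall>q\<in>Q'. size q = 2 \<and> set_mset q \<subseteq> W"
      "\<forall>x\<in>W. {#x, x#} \<in> Q'" "card Q' = card ?Q" "card (cubics_over ?Q) \<le> card (cubics_over Q')"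
      using less.hyps[OF lt less.prems(1), of ?\<phi>] less.prems(2) by auto
    have "card ?Q = Suc (card (Q - {{#x, y#}}))" using x less.prems(2) by simp
    then have "card ?Q = card Q" using Q y less.prems(2) by (metis card.remove)
    moreover have "card (cubics_over Q) \<le> card (cubics_over ?Q)"
      using less.prems(2) \<open>x \<noteq> y\<close> Q y x by (intro cubics_over_square_swap) auto
    ultimately show ?thesis using Q' by (intro exI[of _ Q']) auto
  qed
qed

text \<open>The shape of any set of quadrics that contains the squares of all its variables: mixed
  quadrics are the edges of a simple graph.\<close>

definition graph_quads :: "nat set \<Rightarrow> nat set set \<Rightarrow> monomial set" where
  "graph_quads V E = (\<lambda>x. {#x, x#}) ` V \<union> mset_set ` E"

context
  fixes V E
  assumes G: "graph_on V E"
begin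

lemma graph_quads_iff:
  "{#x, y#} \<in> graph_quads V E \<longleftrightarrow> (if x = y then x \<in> V else {x, y} \<in> E)"
proof -
  have "mset_set e = {#x, y#} \<longleftrightarrow> x \<noteq> y \<and> e = {x, y}" if "e \<in> E" for e
  proof -
    have "card e = 2" using that G by (simp add: graph_on_def)
    then obtain a b where e: "e = {a, b}" "a \<noteq> b" by (meson card_2_iff)
    then show ?thesis by (auto simp: add_eq_conv_ex)
  qed
  then have "(\<exists>e\<in>E. mset_set e = {#x, y#}) \<longleftrightarrow> x \<noteq> y \<and> {x, y} \<in> E" by blast
  then have "{#x, y#} \<in> mset_set ` E \<longleftrightarrow> x \<noteq> y \<and> {x, y} \<in> E" by (simp add: image_iff eq_commute)
  moreover have "{#x, y#} \<in> (\<lambda>x. {#x, x#}) ` V \<longleftrightarrow> x = y \<and> x \<in> V"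
    by (auto simp: add_eq_conv_ex)
  ultimately show ?thesis by (auto simp: graph_quads_def)
qed

lemma finite_edge: "e \<in> E \<Longrightarrow> finite e"
  using G by (meson finite_subset graph_on_def)

lemma size_graph_quads: "q \<in> graph_quads V E \<Longrightarrow> size q = 2"
  using G by (auto simp: graph_quads_def graph_on_def)

lemma vars_graph_quads: "vars (graph_quads V E) = V"
proof -
  have "set_mset (mset_set e) \<subseteq> V" if "e \<in> E" for e
    using that G finite_edge[OF that] by (auto simp: graph_on_def)
  then show ?thesis by (auto simp: vars_def graph_quads_def)
qed

lemma finite_graph_quads: "finite (graph_quads V E)"
  using G finite_edges[OF G] by (simp add: graph_quads_def graph_on_def)

lemma card_graph_quads: "card (graph_quads V E) = card V + card E"
proof -
  have "inj_on mset_set E" using finite_edge by (auto simp: inj_on_def)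
  moreover have "inj_on (\<lambda>x. {#x, x#}) V"
    by (auto intro!: inj_onI dest: arg_cong[where f = set_mset])
  moreover have "(\<lambda>x. {#x, x#}) ` V \<inter> mset_set ` E = {}"
  proof -
    have "{#x, x#} \<noteq> mset_set e" if "e \<in> E" for x e
    proof
      assume "{#x, x#} = mset_set e"
      then have "set_mset {#x, x#} = set_mset (mset_set e)" by simp
      then have "e = {x}" using finite_edge[OF that] by simp
      then show False using that G by (auto simp: graph_on_def)
    qed
    then show ?thesis by blast
  qed
  ultimately show ?thesis
    using G finite_edges[OF G] unfolding graph_quads_def graph_on_def
    by (simp add: card_Un_disjoint card_image)
qed

text \<open>Sorted by support: \<open>x^3\<close> for a vertex, \<open>x^2 y\<close> and
  \<open>x y^2\<close> for an edge (families \<open>?B\<close> and \<open>?C\<close>, repeating its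
  minimum or maximum), and \<open>xyz\<close> for a triangle.\<close>

lemma card_cubics_over_graph_quads:
  "card (cubics_over (graph_quads V E)) = card V + 2 * card E + card (triangles E)"
proof -
  let ?A = "(\<lambda>x. {#x, x, x#}) ` V"
  let ?B = "(\<lambda>e. add_mset (Min e) (mset_set e)) ` E"
  let ?C = "(\<lambda>e. add_mset (Max e) (mset_set e)) ` E"
  let ?D = "mset_set ` triangles E"
  have finV: "finite V" using G by (simp add: graph_on_def)
  note finE = finite_edges[OF G] and finT = finite_triangles[OF G]
  have edge: "\<exists>x y. e = {x, y} \<and> x < y" if "e \<in> E" for e
  proof -
    have "card e = 2" using that G by (simp add: graph_on_def)
    then obtain a b where "e = {a, b}" "a \<noteq> b" by (meson card_2_iff)
    then show ?thesis by (metis insert_commute linorder_neqE_nat)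
  qed
  have setB: "set_mset (add_mset (Min e) (mset_set e)) = e"
    and setC: "set_mset (add_mset (Max e) (mset_set e)) = e" if "e \<in> E" for e
    using edge[OF that] by auto
  have setD: "set_mset (mset_set t) = t" if "t \<in> triangles E" for t
    using finite_triangle[OF that] by simp
  have cardE: "card e = 2" if "e \<in> E" for e using that G by (simp add: graph_on_def)
  have cardT: "card t = 3" if "t \<in> triangles E" for t using that by (simp add: triangles_def)
  have "inj_on (\<lambda>x. {#x, x, x#}) V"
    by (auto intro!: inj_onI dest: arg_cong[where f = set_mset])
  then have cA: "card ?A = card V" by (rule card_image)
  have "inj_on (\<lambda>e. add_mset (Min e) (mset_set e)) E" by (rule inj_onI) (metis setB)
  then have cB: "card ?B = card E" by (rule card_image)
  have "inj_on (\<lambda>e. add_mset (Max e) (mset_set e)) E" by (rule inj_onI) (metis setC)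
  then have cC: "card ?C = card E" by (rule card_image)
  have "inj_on mset_set (triangles E)" by (rule inj_onI) (metis setD)
  then have cD: "card ?D = card (triangles E)" by (rule card_image)
  have sA: "card (set_mset m) = 1" if "m \<in> ?A" for m using that by auto
  have sB: "card (set_mset m) = 2" if "m \<in> ?B" for m using that setB cardE by force
  have sC: "card (set_mset m) = 2" if "m \<in> ?C" for m using that setC cardE by force
  have sD: "card (set_mset m) = 3" if "m \<in> ?D" for m using that setD cardT by force
  \<comment> \<open>Equal supports force the same edge, and then its minimum would equal its
    maximum.\<close>
  have "?B \<inter> ?C = {}"
  proof -
    have "add_mset (Min e) (mset_set e) \<noteq> add_mset (Max f) (mset_set f)" if "e \<in> E" "f \<in> E" for e f
    proof
      assume eq: "add_mset (Min e) (mset_set e) = add_mset (Max f) (mset_set f)"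
      then have "e = f" using setB[OF that(1)] setC[OF that(2)] by metis
      then have "Min e = Max e" using eq by simp
      then show False using edge[OF that(1)] by auto
    qed
    then show ?thesis by blast
  qed
  then have "card (?B \<union> ?C) = 2 * card E"
    using cB cC finE by (simp add: card_Un_disjoint)
  moreover have "?A \<inter> (?B \<union> ?C) = {}"
  proof -
    have "card (set_mset m) \<noteq> 1" if "m \<in> ?B \<union> ?C" for m
      using that sB[of m] sC[of m] by auto
    then show ?thesis using sA by blast
  qed
  ultimately have "card (?A \<union> (?B \<union> ?C)) = card V + 2 * card E"
    using cA finV finE by (simp add: card_Un_disjoint)
  moreover have "(?A \<union> (?B \<union> ?C)) \<inter> ?D = {}"
  proof -
    have "card (set_mset m) \<noteq> 3" if "m \<in> ?A \<union> (?B \<union> ?C)" for m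
      using that sA[of m] sB[of m] sC[of m] by auto
    then show ?thesis using sD by blast
  qed
  ultimately have "card ((?A \<union> (?B \<union> ?C)) \<union> ?D) = card V + 2 * card E + card (triangles E)"
    using cD finV finE finT by (simp add: card_Un_disjoint)
  moreover have "cubics_over (graph_quads V E) = (?A \<union> (?B \<union> ?C)) \<union> ?D"
  proof (intro equalityI subsetI)
    fix m assume m: "m \<in> cubics_over (graph_quads V E)"
    then have "size m = 3" by (simp add: cubics_over_def)
    then obtain x y z where xyz: "m = {#x, y, z#}" "x \<le> y" "y \<le> z"
    proof -
      obtain a b c where "m = {#a, b, c#}" using \<open>size m = 3\<close> by (rule size_3_cases)
      moreover have "{#a, b, c#} = {#a, c, b#}" "{#a, b, c#} = {#b, a, c#}"
        "{#a, b, c#} = {#b, c, a#}" "{#a, b, c#} = {#c, a, b#}" "{#a, b, c#} = {#c, b, a#}"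
        by (simp_all add: add_mset_commute)
      ultimately show thesis using that by (metis nle_le)
    qed
    have q: "{#x, y#} \<in> graph_quads V E" "{#y, z#} \<in> graph_quads V E" "{#x, z#} \<in> graph_quads V E"
      using m by (auto simp: cubics_over_def xyz)
    consider "x = y" "y = z" | "x = y" "y < z" | "x < y" "y = z" | "x < y" "y < z"
      using xyz by linarith
    then show "m \<in> (?A \<union> (?B \<union> ?C)) \<union> ?D"
    proof cases
      case 1
      then show ?thesis using q by (auto simp: graph_quads_iff xyz)
    next
      case 2
      then have "{x, z} \<in> E" "m = add_mset (Min {x, z}) (mset_set {x, z})"
        using q by (auto simp: graph_quads_iff xyz)
      then show ?thesis by blast
    next
      case 3
      then have "{x, z} \<in> E" "m = add_mset (Max {x, z}) (mset_set {x, z})"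
        using q by (auto simp: graph_quads_iff xyz add_mset_commute max_def)
      then show ?thesis by blast
    next
      case 4
      then have E: "{x, y} \<in> E" "{y, z} \<in> E" "{x, z} \<in> E" using q by (auto simp: graph_quads_iff)
      have "e \<in> E" if e: "e \<subseteq> {x, y, z}" "card e = 2" for e
      proof -
        obtain a b where "e = {a, b}" "a \<noteq> b" using e(2) by (meson card_2_iff)
        then show ?thesis using e(1) E by (auto simp: insert_commute)
      qed
      then have "{x, y, z} \<in> triangles E" using 4 by (simp add: triangles_def)
      moreover have "m = mset_set {x, y, z}" using 4 by (simp add: xyz)
      ultimately show ?thesis by blast
    qed
  next
    fix m assume "m \<in> (?A \<union> (?B \<union> ?C)) \<union> ?D"
    then consider x where "x \<in> V" "m = {#x, x, x#}"
      | e where "e \<in> E" "m = add_mset (Min e) (mset_set e) \<or> m = add_mset (Max e) (mset_set e)"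
      | t where "t \<in> triangles E" "m = mset_set t" by blast
    then show "m \<in> cubics_over (graph_quads V E)"
    proof cases
      case 1
      then show ?thesis by (simp add: cubics_over_def graph_quads_iff)
    next
      case 2
      obtain x y where xy: "e = {x, y}" "x < y" using edge[OF 2(1)] by blast
      then have m: "m = {#x, x, y#} \<or> m = {#y, x, y#}" using 2(2) by auto
      have "x \<in> V" "y \<in> V" using 2(1) G xy by (auto simp: graph_on_def)
      moreover have "{y, x} \<in> E" using 2(1) xy by (simp add: insert_commute)
      ultimately show ?thesis using m xy 2(1) by (auto simp: cubics_over_def graph_quads_iff)
    next
      case 3
      obtain x y z where t: "t = {x, y, z}" "x \<noteq> y" "y \<noteq> z" "x \<noteq> z"
        using cardT[OF 3(1)] by (metis card_3_iff)
      then have m: "m = {#x, y, z#}" using 3(2) by simp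
      have "{x, y} \<in> E" "{y, z} \<in> E" "{x, z} \<in> E" using 3(1) t by (auto simp: triangles_def)
      then show ?thesis using t unfolding m by (simp add: cubics_over_def graph_quads_iff)
    qed
  qed
  ultimately show ?thesis by simp
qed

text \<open>The lower end is one cubic per quadric from \<open>squares_cover\<close>, the upper end
  is all cubics over the quadrics; every set in between has the same shadow.\<close>

lemma realizable_of_graph:
  assumes "card V + card E \<le> b" "b \<le> card V + 2 * card E + card (triangles E)"
  shows "realizable (card V) (card V + card E) b"
proof -
  let ?Q = "graph_quads V E"
  have "{#x, x#} \<in> ?Q" if "x \<in> vars ?Q" for x
    using that unfolding vars_graph_quads by (simp add: graph_quads_iff)
  then obtain T0 where T0: "T0 \<subseteq> cubics_over ?Q" "shadow T0 = ?Q" "card T0 = card ?Q"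
    using squares_cover[OF finite_graph_quads size_graph_quads] by blast
  then obtain T where T: "T0 \<subseteq> T" "T \<subseteq> cubics_over ?Q" "card T = b"
    using exists_subset_between[of T0 b "cubics_over ?Q"] assms
      finite_cubics_over[OF finite_graph_quads] card_graph_quads card_cubics_over_graph_quads
    by auto
  have c: "cubics T"
    using T cubics_cubics_over[OF finite_graph_quads] finite_subset unfolding cubics_def by blast
  have "shadow T = ?Q" using shadow_between[of T0 T] T0 T by simp
  then show ?thesis
    using c T vars_eq_vars_shadow[OF c] card_graph_quads vars_graph_quads
    unfolding realizable_def by auto
qed

end

text \<open>Shows that the upper bound in \<open>realizable_of_graph\<close> holds for every set of
  cubics: after \<open>all_squares\<close> the quadrics come from a graph, and there are at least as
  many cubics over them as in \<open>T\<close>.\<close>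

lemma graph_of_cubics:
  assumes T: "cubics T"
  obtains V E where "graph_on V E" "card V = card (vars T)" "card V + card E = card (shadow T)"
    "card T \<le> card V + 2 * card E + card (triangles E)"
proof -
  let ?V = "vars T"
  obtain \<phi> where \<phi>: "inj_on \<phi> ?V" "\<forall>x\<in>?V. x \<in># \<phi> x \<and> \<phi> x \<in> shadow T"
    using distinct_representatives[OF T] by blast
  have "\<And>q. q \<in> shadow T \<Longrightarrow> size q = 2 \<and> set_mset q \<subseteq> ?V"
    using in_shadow_size in_shadow_vars by blast
  then obtain Q where Q: "finite Q" "\<forall>q\<in>Q. size q = 2 \<and> set_mset q \<subseteq> ?V"
    "\<forall>x\<in>?V. {#x, x#} \<in> Q" "card Q = card (shadow T)"
    "card (cubics_over (shadow T)) \<le> card (cubics_over Q)"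
    using all_squares[OF finite_vars[OF T] finite_shadow[OF T] _ \<phi>(1)] \<phi>(2) by blast
  define E where "E = {e. e \<subseteq> ?V \<and> card e = 2 \<and> mset_set e \<in> Q}"
  have G: "graph_on ?V E" using finite_vars[OF T] by (auto simp: graph_on_def E_def)
  have "Q = graph_quads ?V E"
  proof (intro equalityI subsetI)
    fix q assume q: "q \<in> Q"
    then have "size q = 2" using Q(2) by blast
    then obtain x y where xy: "q = {#x, y#}" by (rule size_2_cases)
    have "x \<in> ?V" "y \<in> ?V" using Q(2) q xy by auto
    then show "q \<in> graph_quads ?V E"
      using q unfolding xy graph_quads_iff[OF G] by (auto simp: E_def)
  qed (use Q(3) in \<open>auto simp: graph_quads_def E_def\<close>)
  moreover have "card T \<le> card (cubics_over (shadow T))"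
    using subset_cubics_over_shadow[OF T] finite_cubics_over[OF finite_shadow[OF T]]
    by (rule card_mono[rotated])
  ultimately show thesis
    using that[OF G] Q(4,5) card_graph_quads[OF G] card_cubics_over_graph_quads[OF G] by simp
qed

subsection \<open>The interval property\<close>

text \<open>\<open>n + (n choose 2)\<close> is the number of all quadrics in \<open>n\<close>
  variables.\<close>

lemma add_choose_two_mono:
  fixes m n :: nat
  assumes "m \<le> n"
  shows "m + (m choose 2) \<le> n + (n choose 2)"
  unfolding choose_two using assms by (intro add_mono div_le_mono mult_le_mono) auto

text \<open>If the quadrics fit into \<open>r\<close> variables, they fit into any larger number, so
  each single deletion has room for its extra edge.\<close>

lemma delete_vertices:
  assumes "graph_on V E" "r \<le> card V" "card V + card E \<le> r + (r choose 2)"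
  shows "\<exists>V' E'. graph_on V' E' \<and> card V' = r \<and> card V' + card E' = card V + card E \<and>
    card (triangles E) \<le> card (triangles E')"
  using assms
proof (induction "card V - r" arbitrary: V E)
  case 0
  then show ?case by (intro exI[of _ V] exI[of _ E]) auto
next
  case (Suc n)
  have "V \<noteq> {}" using Suc.hyps(2) by auto
  then obtain v where v: "v \<in> V" by blast
  have fin: "finite V" using Suc.prems(1) by (simp add: graph_on_def)
  have "r \<le> card V - 1" using Suc.hyps(2) by linarith
  then have "card V + card E \<le> (card V - 1) + ((card V - 1) choose 2)"
    using Suc.prems(3) add_choose_two_mono[of r "card V - 1"] by linarith
  then have "Suc (card E) \<le> (card V - 1) choose 2" using Suc.hyps(2) by linarith
  then obtain E1 where E1: "graph_on (V - {v}) E1" "card E1 = Suc (card E)"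
    "card (triangles E) \<le> card (triangles E1)"
    using delete_vertex[OF Suc.prems(1) v] by blast
  have cV: "card V = Suc (card (V - {v}))" using fin v by (metis card.remove)
  then have "\<exists>V' E'. graph_on V' E' \<and> card V' = r \<and> card V' + card E' = card (V - {v}) + card E1 \<and>
    card (triangles E1) \<le> card (triangles E')"
    using Suc.hyps E1(1,2) Suc.prems(3) by (intro Suc.hyps(1)) auto
  then show ?case using E1 cV order_trans by fastforce
qed

text \<open>For \<open>b \<le> a\<close> variables are added starting from \<open>r'\<close>, and
  \<open>r''\<close> only bounds \<open>r\<close> by \<open>a\<close>. For \<open>b > a\<close>
  vertices are deleted starting from a graph for \<open>r''\<close>.\<close>

lemma realizable_interval_vars:
  assumes "realizable r' a b" "realizable r'' a b" "r' \<le> r" "r \<le> r''"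
  shows "realizable r a b"
proof (cases "b \<le> a")
  case True
  obtain T where T: "cubics T" "card (vars T) = r'" "card (shadow T) = a" "card T = b"
    using assms(1) by (auto simp: realizable_def)
  have "r'' \<le> a" using assms(2) card_vars_le_card_shadow by (auto simp: realizable_def)
  then show ?thesis using realizable_low[OF T(1), of r a b] T True assms by simp
next
  case False
  obtain T' where T': "cubics T'" "card (vars T') = r'" "card (shadow T') = a"
    using assms(1) by (auto simp: realizable_def)
  obtain V' E' where G': "graph_on V' E'" "card V' = r'" "card V' + card E' = a"
    using graph_of_cubics[OF T'(1)] T' by metis
  \<comment> \<open>The end \<open>r'\<close> shows that \<open>a\<close> quadrics fit into
    \<open>r\<close> variables, as \<open>delete_vertices\<close> requires.\<close>
  have a: "a \<le> r + (r choose 2)"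
    using card_edges_le[OF G'(1), unfolded G'(2)] G'(2,3) add_choose_two_mono[OF assms(3)] by linarith
  obtain T'' where T'': "cubics T''" "card (vars T'') = r''" "card (shadow T'') = a" "card T'' = b"
    using assms(2) by (auto simp: realizable_def)
  obtain V'' E'' where G'': "graph_on V'' E''" "card V'' = r''" "card V'' + card E'' = a"
    "b \<le> card V'' + 2 * card E'' + card (triangles E'')"
    using graph_of_cubics[OF T''(1)] T'' by metis
  obtain V E where G: "graph_on V E" "card V = r" "card V + card E = a"
    "card (triangles E'') \<le> card (triangles E)"
    using delete_vertices[OF G''(1), of r] G''(2,3) assms(4) a by auto
  \<comment> \<open>With \<open>p\<close> edges, \<open>r + 2 * p\<close> equals
    \<open>2 * a - r\<close>, so this part of the bound on \<open>b\<close> grows as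
    \<open>r\<close> decreases.\<close>
  then show ?thesis
    using realizable_of_graph[OF G(1), of b] G''(2-4) False assms(4) by simp
qed

text \<open>For \<open>b \<le> a\<close> the quadrics are lowered from \<open>a''\<close>. For
  \<open>b > a\<close> edges are added to a graph for \<open>a'\<close>, and \<open>a''\<close>
  guarantees that enough edges are missing.\<close>

lemma realizable_interval_shadow:
  assumes "realizable r a' b" "realizable r a'' b" "a' \<le> a" "a \<le> a''"
  shows "realizable r a b"
proof -
  obtain T' where T': "cubics T'" "card (vars T') = r" "card (shadow T') = a'" "card T' = b"
    using assms(1) by (auto simp: realizable_def)
  obtain T'' where T'': "cubics T''" "card (vars T'') = r" "card (shadow T'') = a''" "card T'' = b"
    using assms(2) by (auto simp: realizable_def)
  show ?thesis
  proof (cases "b \<le> a")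
    case True
    have "r \<le> a'" using card_vars_le_card_shadow[OF T'(1)] T' by simp
    then show ?thesis using realizable_low[OF T''(1), of r a b] T'' True assms by simp
  next
    case False
    obtain V'' E'' where G'': "graph_on V'' E''" "card V'' = r" "card V'' + card E'' = a''"
      using graph_of_cubics[OF T''(1)] T'' by metis
    obtain V E' where G': "graph_on V E'" "card V = r" "card V + card E' = a'"
      "b \<le> card V + 2 * card E' + card (triangles E')"
      using graph_of_cubics[OF T'(1)] T' by metis
    have "card E' + (a - a') \<le> card V choose 2"
      using card_edges_le[OF G''(1)] G'' G' assms(3,4) by simp
    \<comment> \<open>With \<open>D = {}\<close>, \<open>add_edges\<close> just says that new edges
      destroy no triangle.\<close>
    then obtain E where E: "graph_on V E" "card E = card E' + (a - a')"
      "card (triangles E') \<le> card (triangles E)"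
      using add_edges[OF G'(1), of "{}" "a - a'"] by auto
    have "card V + card E = a" using E(2) G'(3) assms(3) by linarith
    moreover have "b \<le> card V + 2 * card E + card (triangles E)" using E(2,3) G'(4) by linarith
    ultimately show ?thesis
      using realizable_of_graph[OF E(1), of b] G'(2) False by simp
  qed
qed

text \<open>The end \<open>b'\<close> gives a set of cubics to enlarge when
  \<open>b \<le> a\<close>; the end \<open>b''\<close> gives the graph bound when
  \<open>b > a\<close>.\<close>

lemma realizable_interval_card:
  assumes "realizable r a b'" "realizable r a b''" "b' \<le> b" "b \<le> b''"
  shows "realizable r a b"
proof (cases "b \<le> a")
  case True
  obtain T where T: "cubics T" "card (vars T) = r" "card (shadow T) = a" "card T = b'"
    using assms(1) by (auto simp: realizable_def)
  then show ?thesis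
    using realizable_low[OF T(1), of r a b] True assms card_vars_le_card_shadow[OF T(1)] by simp
next
  case False
  obtain T where T: "cubics T" "card (vars T) = r" "card (shadow T) = a" "card T = b''"
    using assms(2) by (auto simp: realizable_def)
  obtain V E where G: "graph_on V E" "card V = r" "card V + card E = a"
    "b'' \<le> card V + 2 * card E + card (triangles E)"
    using graph_of_cubics[OF T(1)] T by metis
  then show ?thesis using realizable_of_graph[OF G(1), of b] False assms(4) by simp
qed

theorem theorem4p3:
  shows "(\<forall>h1' h1 h1'' h2 h3.
            [1, h1', h2, h3] \<in> pure_O_sequences 3 \<and> [1, h1'', h2, h3] \<in> pure_O_sequences 3 \<and>
            h1' \<le> h1 \<and> h1 \<le> h1'' \<longrightarrow> [1, h1, h2, h3] \<in> pure_O_sequences 3) \<and>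
         (\<forall>h1 h2' h2 h2'' h3.
            [1, h1, h2', h3] \<in> pure_O_sequences 3 \<and> [1, h1, h2'', h3] \<in> pure_O_sequences 3 \<and>
            h2' \<le> h2 \<and> h2 \<le> h2'' \<longrightarrow> [1, h1, h2, h3] \<in> pure_O_sequences 3) \<and>
         (\<forall>h1 h2 h3' h3 h3''.
            [1, h1, h2, h3'] \<in> pure_O_sequences 3 \<and> [1, h1, h2, h3''] \<in> pure_O_sequences 3 \<and>
            h3' \<le> h3 \<and> h3 \<le> h3'' \<longrightarrow> [1, h1, h2, h3] \<in> pure_O_sequences 3)"
proof (intro conjI allI impI; elim conjE)
  fix h1' h1 h1'' h2 h3
  assume "[1, h1', h2, h3] \<in> pure_O_sequences 3" "[1, h1'', h2, h3] \<in> pure_O_sequences 3"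
    "h1' \<le> h1" "h1 \<le> h1''"
  then show "[1, h1, h2, h3] \<in> pure_O_sequences 3"
    unfolding realizable_iff using realizable_interval_vars by blast
next
  fix h1 h2' h2 h2'' h3
  assume "[1, h1, h2', h3] \<in> pure_O_sequences 3" "[1, h1, h2'', h3] \<in> pure_O_sequences 3"
    "h2' \<le> h2" "h2 \<le> h2''"
  then show "[1, h1, h2, h3] \<in> pure_O_sequences 3"
    unfolding realizable_iff using realizable_interval_shadow by blast
next
  fix h1 h2 h3' h3 h3''
  assume "[1, h1, h2, h3'] \<in> pure_O_sequences 3" "[1, h1, h2, h3''] \<in> pure_O_sequences 3"
    "h3' \<le> h3" "h3 \<le> h3''"
  then show "[1, h1, h2, h3] \<in> pure_O_sequences 3"
    unfolding realizable_iff using realizable_interval_card by (meson less_le_trans)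
qed

end
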